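(* Let $0<\alpha<2$, $H>0$, $H'>0$ and $N,d\ge 1$. Let $(X_s)_{s\in\mathbb{R}^d}$ be a measurable $(\alpha,H)$-FSF on a probability space $(\Omega,\mathcal{F},\mathbf{P})$, let $\{f_s\}_{s\in\mathbb{R}^d}\subset L^\alpha(E,m)$ be a jointly measurable representation of $X$, and let $(\tau_t)_{t\in\mathbb{R}^N}$ be a measurable $(N,d,H')$-field on a different probability space $(\Omega',\mathcal{F}',\mathbf{P}')$ with $\mathbf{E}'\|\tau_t\|^{H\alpha}<\infty$ for all $t\in\mathbb{R}^N$. Let $X^\tau=(X^\tau_t)_{t\in\mathbb{R}^N}$ be the $\alpha$-stabilized subordination of $X$ with respect to $\tau$. Let $X^{(1)},X^{(2)},\ldots$ be i.i.d. copies of the (measurable) field $X$ and $\tau^{(1)},\tau^{(2)},\ldots$ be i.i.d. copies of $\tau$, the two sequences being independent of each other. Then, as $n\to\infty$, $$ n^{-1/\alpha}\sum_{l=1}^n X^{(l)}_{\tau^{(l)}_t}\ \Longrightarrow\ X^\tau_t $$ in the sense of convergence of finite-dimensional distributions of processes indexed by $t\in\mathbb{R}^N$.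
   Context: Rigid motions and stationary increments: $\mathcal{G}(\mathbb{R}^N)$ is the set of Euclidean rigid motions of $\mathbb{R}^N$. A (real- or vector-valued) random field $(Z_t)_{t\in\mathbb{R}^N}$ has stationary increments in the strong sense (sis) if for all $g\in\mathcal{G}(\mathbb{R}^N)$, $(Z_{g(t)}-Z_{g(0)})_{t\in\mathbb{R}^N}$ and $(Z_t-Z_0)_{t\in\mathbb{R}^N}$ have the same finite-dimensional distributions. It is $H$-self-similar if for all $c>0$, $(Z_{ct})_t$ and $(c^HZ_t)_t$ have the same finite-dimensional distributions. It is $H$-sssis if both hold. An $(\alpha,H)$-FSF (isotropic fractional stable field) is a (jointly) measurable real-valued field that is symmetric $\alpha$-stable (S$\alpha$S) and $H$-sssis. An $(N,d,H')$-field is an $\mathbb{R}^d$-valued random field indexed by $\mathbb{R}^N$ that is $H'$-sssis. Representation: given a measure space $(E,\mathcal{B},m)$ with $m$ $\sigma$-finite, let $M_\alpha$ be an S$\alpha$S random measure with control measure $m$. A family $\{f_s\}_{s\in S}\subset L^\alpha(E,m)$ is a representation (with control measure $m$) of an S$\alpha$S process $(X_s)_{s\in S}$ if $X$ has the same finite-dimensional distributions as $\left(\int_E f_s\,dM_\alpha\right)_{s\in S}$; equivalently, for all $\theta_j\in\mathbb{R}$, $s_j\in S$, $\mathbf{E}\exp\big(i\sum_{j}\theta_jX_{s_j}\big)=\exp\big(-\int_E|\sum_{j}\theta_jf_{s_j}(x)|^\alpha\,m(dx)\big)$. Jointly measurable means that $(s,x)\mapsto f_s(x)$ is measurable. $\alpha$-stabilized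 subordination: for $X$, $\{f_s\}$, $\tau$ as in the claim, $$X^\tau_t:=\int_{E\times\Omega'}f_{\tau_t(\omega')}(x)\,M_\alpha(dx\times d\omega'),\qquad t\in\mathbb{R}^N,$$ where $M_\alpha$ is an S$\alpha$S random measure on $E\times\Omega'$ with control measure $m\times\mathbf{P}'$; that is, $X^\tau$ is the S$\alpha$S process represented by the family $\{f_{\tau_t}\}_{t\in\mathbb{R}^N}\subset L^\alpha(\Omega'\times E,\mathbf{P}'\times m)$. $\mathbf{E}'$ denotes expectation under $\mathbf{P}'$. *)

theory Defs
  imports "HOL-Probability.Probability"
begin

section \<open>Finite-dimensional distributions\<close>

definition fdd ::
    "'w measure \<Rightarrow> ('s \<Rightarrow> 'w \<Rightarrow> 'a::topological_space) \<Rightarrow> 's set \<Rightarrow> ('s \<Rightarrow> 'a) measure" where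
  "fdd P Z J = distr P (\<Pi>\<^sub>M s\<in>J. borel) (\<lambda>w. \<lambda>s\<in>J. Z s w)"

definition same_fdd ::
    "'w measure \<Rightarrow> ('s \<Rightarrow> 'w \<Rightarrow> 'a::topological_space) \<Rightarrow> 'v measure \<Rightarrow> ('s \<Rightarrow> 'v \<Rightarrow> 'a) \<Rightarrow> bool" where
  "same_fdd P Z Q Y \<longleftrightarrow> (\<forall>J. finite J \<longrightarrow> fdd P Z J = fdd Q Y J)"

text \<open>Weak convergence of each finite-dimensional distribution. The set of extensional functions on
  a finite set \<open>J\<close>, with the topology of pointwise convergence, plays the role of the product space
  with index set \<open>J\<close>.\<close>

definition fdd_converges ::
    "'w measure \<Rightarrow> (nat \<Rightarrow> 's \<Rightarrow> 'w \<Rightarrow> real) \<Rightarrow> 'v measure \<Rightarrow> ('s \<Rightarrow> 'v \<Rightarrow> real) \<Rightarrow> bool" where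
  "fdd_converges P Y Q Z \<longleftrightarrow>
     (\<forall>J (\<phi> :: ('s \<Rightarrow> real) \<Rightarrow> real). finite J \<longrightarrow>
        continuous_on (PiE J (\<lambda>_. UNIV)) \<phi> \<longrightarrow> bounded (\<phi> ` PiE J (\<lambda>_. UNIV)) \<longrightarrow>
        (\<lambda>n. \<integral>y. \<phi> y \<partial>fdd P (Y n) J) \<longlonglongrightarrow> (\<integral>y. \<phi> y \<partial>fdd Q Z J))"


section \<open>Stationary increments, self-similarity, stability\<close>

definition measurable_field ::
    "'w measure \<Rightarrow> ('s::topological_space \<Rightarrow> 'w \<Rightarrow> 'a::topological_space) \<Rightarrow> bool" where
  "measurable_field P Z \<longleftrightarrow> (\<lambda>(s, w). Z s w) \<in> borel_measurable (borel \<Otimes>\<^sub>M P)"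

text \<open>Rigid motions are compositions of rotations and translations. Under the convention that
  reflections are rigid motions too, stationarity of the increments below is a stronger
  requirement, so that a result assuming it only for the motions below covers that convention
  as well.\<close>

definition rigid_motions :: "(real^'n \<Rightarrow> real^'n) set" where
  "rigid_motions = {g. \<exists>A b. rotation_matrix A \<and> g = (\<lambda>t. A *v t + b)}"

definition stationary_increments_strong ::
    "'w measure \<Rightarrow> (real^'n \<Rightarrow> 'w \<Rightarrow> 'a::real_normed_vector) \<Rightarrow> bool" where
  "stationary_increments_strong P Z \<longleftrightarrow>
     (\<forall>g\<in>rigid_motions. same_fdd P (\<lambda>t w. Z (g t) w - Z (g 0) w) P (\<lambda>t w. Z t w - Z 0 w))"

definition self_similar ::
    "real \<Rightarrow> 'w measure \<Rightarrow> (real^'n \<Rightarrow> 'w \<Rightarrow> 'a::real_normed_vector) \<Rightarrow> bool" where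
  "self_similar H P Z \<longleftrightarrow>
     (\<forall>c>0. same_fdd P (\<lambda>t. Z (c *\<^sub>R t)) P (\<lambda>t w. (c powr H) *\<^sub>R Z t w))"

definition sssis ::
    "real \<Rightarrow> 'w measure \<Rightarrow> (real^'n \<Rightarrow> 'w \<Rightarrow> 'a::real_normed_vector) \<Rightarrow> bool" where
  "sssis H P Z \<longleftrightarrow> self_similar H P Z \<and> stationary_increments_strong P Z"

text \<open>A law \<open>\<mu>\<close> on a finite product space is symmetric \<open>\<alpha>\<close>-stable if it is symmetric and, for
  independent \<open>x\<close>, \<open>y\<close> with law \<open>\<mu>\<close> and all \<open>a, b > 0\<close>, the vector \<open>a x + b y\<close> has the law of
  \<open>(a\<^sup>\<alpha> + b\<^sup>\<alpha>)\<^sup>1\<^sup>/\<^sup>\<alpha> x + D\<close> for some constant vector \<open>D\<close>.\<close>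

definition symmetric_stable_law :: "real \<Rightarrow> 's set \<Rightarrow> ('s \<Rightarrow> real) measure \<Rightarrow> bool" where
  "symmetric_stable_law \<alpha> J \<mu> \<longleftrightarrow>
     distr \<mu> (\<Pi>\<^sub>M s\<in>J. borel) (\<lambda>x. \<lambda>s\<in>J. - x s) = \<mu> \<and>
     (\<forall>a>0. \<forall>b>0. \<exists>D.
        distr (\<mu> \<Otimes>\<^sub>M \<mu>) (\<Pi>\<^sub>M s\<in>J. borel) (\<lambda>(x, y). \<lambda>s\<in>J. a * x s + b * y s) =
        distr \<mu> (\<Pi>\<^sub>M s\<in>J. borel) (\<lambda>x. \<lambda>s\<in>J. (a powr \<alpha> + b powr \<alpha>) powr (1/\<alpha>) * x s + D s))"

definition symmetric_stable :: "real \<Rightarrow> 'w measure \<Rightarrow> ('s \<Rightarrow> 'w \<Rightarrow> real) \<Rightarrow> bool" where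
  "symmetric_stable \<alpha> P Z \<longleftrightarrow> (\<forall>J. finite J \<longrightarrow> symmetric_stable_law \<alpha> J (fdd P Z J))"

definition fractional_stable_field ::
    "real \<Rightarrow> real \<Rightarrow> 'w measure \<Rightarrow> (real^'d \<Rightarrow> 'w \<Rightarrow> real) \<Rightarrow> bool" where
  "fractional_stable_field \<alpha> H P X \<longleftrightarrow>
     measurable_field P X \<and> symmetric_stable \<alpha> P X \<and> sssis H P X"


section \<open>Stable random measures and stable integrals\<close>

definition finite_measure_sets :: "'e measure \<Rightarrow> 'e set set" where
  "finite_measure_sets m = {A \<in> sets m. emeasure m A < \<infinity>}"

definition L_alpha :: "real \<Rightarrow> 'e measure \<Rightarrow> ('e \<Rightarrow> real) set" where
  "L_alpha \<alpha> m = {f \<in> borel_measurable m. integrable m (\<lambda>x. \<bar>f x\<bar> powr \<alpha>)}"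

text \<open>An independently scattered, almost surely \<open>\<sigma>\<close>-additive random set function on the sets of
  finite \<open>m\<close>-measure whose value on \<open>A\<close> is symmetric \<open>\<alpha>\<close>-stable with scale \<open>m(A)\<^sup>1\<^sup>/\<^sup>\<alpha>\<close>.
  Independence of a sequence means independence of its finite subfamilies, so finitely many
  disjoint sets are covered by padding with empty sets.\<close>

definition stable_random_measure ::
    "real \<Rightarrow> 'e measure \<Rightarrow> 'v measure \<Rightarrow> ('e set \<Rightarrow> 'v \<Rightarrow> real) \<Rightarrow> bool" where
  "stable_random_measure \<alpha> m Q M \<longleftrightarrow>
     prob_space Q \<and>
     (\<forall>A\<in>finite_measure_sets m. M A \<in> borel_measurable Q \<and>
        (\<forall>\<theta>. char (distr Q borel (M A)) \<theta> = exp (- (measure m A * \<bar>\<theta>\<bar> powr \<alpha>)))) \<and>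
     (\<forall>A :: nat \<Rightarrow> 'e set. range A \<subseteq> finite_measure_sets m \<longrightarrow> disjoint_family A \<longrightarrow>
        prob_space.indep_vars Q (\<lambda>_. borel) (\<lambda>i. M (A i)) UNIV) \<and>
     (\<forall>A :: nat \<Rightarrow> 'e set. range A \<subseteq> finite_measure_sets m \<longrightarrow> disjoint_family A \<longrightarrow>
        (\<Union>i. A i) \<in> finite_measure_sets m \<longrightarrow>
        (AE w in Q. (\<lambda>i. M (A i) w) sums M (\<Union>i. A i) w))"

definition converges_in_probability ::
    "'v measure \<Rightarrow> (nat \<Rightarrow> 'v \<Rightarrow> real) \<Rightarrow> ('v \<Rightarrow> real) \<Rightarrow> bool" where
  "converges_in_probability Q Y Z \<longleftrightarrow>
     (\<forall>\<epsilon>>0. (\<lambda>n. measure Q {w \<in> space Q. \<bar>Y n w - Z w\<bar> > \<epsilon>}) \<longlonglongrightarrow> 0)"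

definition simple_L_alpha :: "'e measure \<Rightarrow> ('e \<Rightarrow> real) set" where
  "simple_L_alpha m =
     {g. simple_function m g \<and> emeasure m {x \<in> space m. g x \<noteq> 0} < \<infinity>}"

definition simple_stable_integral ::
    "'e measure \<Rightarrow> ('e set \<Rightarrow> 'v \<Rightarrow> real) \<Rightarrow> ('e \<Rightarrow> real) \<Rightarrow> 'v \<Rightarrow> real" where
  "simple_stable_integral m M g w =
     (\<Sum>c\<in>g ` space m - {0}. c * M (g -` {c} \<inter> space m) w)"

text \<open>\<open>has_stable_integral \<alpha> m Q M f Y\<close>: \<open>f\<close> belongs to \<open>L\<^sup>\<alpha>(m)\<close> and \<open>Y\<close> is (a version of) the
  integral of \<open>f\<close> with respect to \<open>M\<close>, the limit in probability of the integrals of simple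
  functions converging to \<open>f\<close> in \<open>L\<^sup>\<alpha>(m)\<close>.\<close>

definition has_stable_integral ::
    "real \<Rightarrow> 'e measure \<Rightarrow> 'v measure \<Rightarrow> ('e set \<Rightarrow> 'v \<Rightarrow> real) \<Rightarrow> ('e \<Rightarrow> real) \<Rightarrow> ('v \<Rightarrow> real) \<Rightarrow> bool"
  where
  "has_stable_integral \<alpha> m Q M f Y \<longleftrightarrow>
     f \<in> L_alpha \<alpha> m \<and> Y \<in> borel_measurable Q \<and>
     (\<exists>g :: nat \<Rightarrow> 'e \<Rightarrow> real. (\<forall>n. g n \<in> simple_L_alpha m) \<and>
        (\<lambda>n. \<integral>x. \<bar>g n x - f x\<bar> powr \<alpha> \<partial>m) \<longlonglongrightarrow> 0 \<and>
        converges_in_probability Q (\<lambda>n. simple_stable_integral m M (g n)) Y)"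

text \<open>The family \<open>f\<close> represents the process \<open>X\<close>: the latter has the finite-dimensional
  distributions of the integrals of the \<open>f s\<close> with respect to the random measure \<open>M\<close>.\<close>

definition stable_representation ::
    "real \<Rightarrow> 'e measure \<Rightarrow> 'v measure \<Rightarrow> ('e set \<Rightarrow> 'v \<Rightarrow> real) \<Rightarrow> ('s \<Rightarrow> 'e \<Rightarrow> real) \<Rightarrow>
     'w measure \<Rightarrow> ('s \<Rightarrow> 'w \<Rightarrow> real) \<Rightarrow> bool" where
  "stable_representation \<alpha> m Q M f P X \<longleftrightarrow>
     (\<exists>I. (\<forall>s. has_stable_integral \<alpha> m Q M (f s) (I s)) \<and> same_fdd P X Q I)"

definition stabilized_subordination ::
    "real \<Rightarrow> 'e measure \<Rightarrow> ('s \<Rightarrow> 'e \<Rightarrow> real) \<Rightarrow> 'p measure \<Rightarrow> ('t \<Rightarrow> 'p \<Rightarrow> 's) \<Rightarrow>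
     'v measure \<Rightarrow> (('e \<times> 'p) set \<Rightarrow> 'v \<Rightarrow> real) \<Rightarrow> ('t \<Rightarrow> 'v \<Rightarrow> real) \<Rightarrow> bool" where
  "stabilized_subordination \<alpha> m f P' \<tau> Q M X\<tau> \<longleftrightarrow>
     stable_random_measure \<alpha> (m \<Otimes>\<^sub>M P') Q M \<and>
     (\<forall>t. has_stable_integral \<alpha> (m \<Otimes>\<^sub>M P') Q M (\<lambda>(x, w'). f (\<tau> t w') x) (X\<tau> t))"


section \<open>Independent copies\<close>

text \<open>\<open>XX 0, XX 1, \<dots>\<close> are copies of the measurable field \<open>X\<close> and \<open>TT 0, TT 1, \<dots>\<close> are copies of
  \<open>T\<close>, all of them mutually independent (each sequence is i.i.d. and the two sequences are
  independent of each other). Independence of measurable fields has to be read with care, as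
  \<open>XX l\<close> is going to be evaluated at the random point \<open>TT l t\<close>. The \<open>\<sigma>\<close>-algebra generated by the
  single variables \<open>XX l s\<close> does not suffice: adding to \<open>XX l s\<close> the indicator of \<open>{TT l t = s}\<close>,
  for a fixed \<open>t\<close> at which \<open>TT l t\<close> has a diffuse law, changes neither the finite-dimensional
  distributions nor the independence of these \<open>\<sigma>\<close>-algebras (nor joint measurability), but it
  changes the composition. Hence \<open>XX l\<close> is a copy as a measurable field: it is jointly measurable
  with respect to a \<open>\<sigma>\<close>-algebra \<open>F l\<close> that is part of the independent family, as is the case when
  \<open>XX l\<close> is a function of the \<open>l\<close>-th coordinate of a product space.\<close>

definition independent_copies ::
    "'r measure \<Rightarrow> 'w measure \<Rightarrow> ('s::topological_space \<Rightarrow> 'w \<Rightarrow> real) \<Rightarrow>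
     'p measure \<Rightarrow> ('t \<Rightarrow> 'p \<Rightarrow> 's) \<Rightarrow>
     (nat \<Rightarrow> 's \<Rightarrow> 'r \<Rightarrow> real) \<Rightarrow> (nat \<Rightarrow> 't \<Rightarrow> 'r \<Rightarrow> 's) \<Rightarrow> bool" where
  "independent_copies R P X P' T XX TT \<longleftrightarrow>
     (\<forall>l. same_fdd R (XX l) P X) \<and> (\<forall>l. same_fdd R (TT l) P' T) \<and>
     (\<exists>F G :: nat \<Rightarrow> 'r measure.
        (\<forall>l. subalgebra R (F l) \<and> measurable_field (F l) (XX l)) \<and>
        (\<forall>l. subalgebra R (G l) \<and> (\<forall>t. TT l t \<in> borel_measurable (G l))) \<and>
        prob_space.indep_sets R (case_sum (\<lambda>l. sets (F l)) (\<lambda>l. sets (G l))) UNIV)"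

end

theory Submission
  imports Defs
begin

text \<open>Given \<open>\<tau>\<close>, a linear combination of the values \<open>X\<^bsub>\<tau>\<^sub>t\<^esub>\<close> with coefficients \<open>a\<^sub>t\<close> is
  symmetric stable with scale \<open>K\<^sup>1\<^sup>/\<^sup>\<alpha>\<close>, where \<open>K = \<integral> \<bar>\<Sum>\<^sub>t a\<^sub>t f\<^bsub>\<tau>\<^sub>t\<^esub>\<bar>\<^sup>\<alpha> dm\<close> is a function of \<open>\<tau>\<close>. By
  independence the characteristic function of the normalized sum is therefore
  \<open>(E' exp (- K / n))\<^sup>n\<close>, which tends to \<open>exp (- E' K)\<close>, the characteristic function of the same linear
  combination of the values of \<open>X\<^sup>\<tau>\<close>. That \<open>K\<close> is integrable is contained in the membership of
  \<open>f\<^bsub>\<tau>\<^sub>t\<^esub>\<close> in \<open>L\<^sup>\<alpha>(m \<times> P')\<close>. A multidimensional continuity theorem for characteristic functions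
  completes the argument.\<close>

section \<open>Finite-dimensional convergence from characteristic functions\<close>

text \<open>Three obstacles shape the proof. For \<alpha> < 1 the integral of |f|^\<alpha> gives no
  norm, and a stable integral is known only as a limit in probability of simple integrals whose
  random measure is additive merely almost surely. So its characteristic function is computed for
  simple functions and carried to the limit by an elementary inequality that holds for all \<alpha>
  > 0. Next, the field is read at random points. Joint measurability over \<open>F l\<close> makes
  the composition a measurable function of a pair taken on its diagonal, and independence of
  \<open>F l\<close> and \<open>G l\<close> allows Fubini to freeze the points; at frozen points the
  representation applies. Finally, in the continuity theorem the mass outside a box must be small
  uniformly in n; this comes from the one-dimensional Levy theorem, applied to each
  coordinate.\<close>

text \<open>The complex span of the characters. With an inductive set in place of explicit finite
  sums, every claim that is linear in the function is a two-case induction.\<close>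

inductive_set trig_poly :: "'s set \<Rightarrow> (('s \<Rightarrow> real) \<Rightarrow> complex) set" for J where
  single: "(\<lambda>x. c * iexp (\<Sum>j\<in>J. a j * x j)) \<in> trig_poly J"
| add: "p \<in> trig_poly J \<Longrightarrow> q \<in> trig_poly J \<Longrightarrow> (\<lambda>x. p x + q x) \<in> trig_poly J"

lemma trig_poly_mult_single:
  assumes "q \<in> trig_poly J"
  shows "(\<lambda>x. c * iexp (\<Sum>j\<in>J. a j * x j) * q x) \<in> trig_poly J"
  using assms
proof induction
  case (single d b)
  have "(\<lambda>x. c * iexp (\<Sum>j\<in>J. a j * x j) * (d * iexp (\<Sum>j\<in>J. b j * x j))) =
      (\<lambda>x. (c * d) * iexp (\<Sum>j\<in>J. (a j + b j) * x j))"
    by (simp add: fun_eq_iff distrib_right distrib_left sum.distrib exp_add)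
  then show ?case using trig_poly.single[of "c * d" "\<lambda>j. a j + b j" J] by simp
next
  case (add p q)
  then show ?case using trig_poly.add[OF add.IH] by (simp add: distrib_left)
qed

text \<open>With sums and constants this gives an algebra, as Stone-Weierstrass requires.\<close>

lemma trig_poly_mult:
  assumes "p \<in> trig_poly J" "q \<in> trig_poly J"
  shows "(\<lambda>x. p x * q x) \<in> trig_poly J"
  using assms
proof induction
  case (single c a)
  then show ?case by (rule trig_poly_mult_single)
next
  case (add p p')
  then show ?case
    using trig_poly.add[of "\<lambda>x. p x * q x" J "\<lambda>x. p' x * q x"] by (simp add: distrib_right)
qed

lemma trig_poly_const: "(\<lambda>x. c) \<in> trig_poly J"
  using trig_poly.single[of c "\<lambda>_. 0" J] by simp

text \<open>When sines are substituted for the coordinates of a cube, the coordinate functions,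
  which separate points, become these functions.\<close>

lemma trig_poly_sin:
  assumes "finite J" "j \<in> J"
  shows "(\<lambda>x. complex_of_real (sin (a * x j))) \<in> trig_poly J"
proof -
  have *: "(\<lambda>x. c * iexp (b * x j)) \<in> trig_poly J" for c b
    using trig_poly.single[of c "\<lambda>i. if i = j then b else 0" J] assms
    by (simp add: if_distrib[of "\<lambda>y. y * _"] sum.delta cong: if_cong)
  have "(\<lambda>x. complex_of_real (sin (a * x j))) =
      (\<lambda>x. (1 / (2 * \<i>)) * iexp (a * x j) + (- 1 / (2 * \<i>)) * iexp ((- a) * x j))"
    by (simp add: fun_eq_iff sin_of_real[symmetric] sin_exp_eq diff_divide_distrib mult.commute mult.left_commute)
  then show ?thesis using trig_poly.add[OF *[of "1 / (2 * \<i>)" a] *[of "- 1 / (2 * \<i>)" "- a"]]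
    by simp
qed

lemma trig_poly_measurable:
  assumes "q \<in> trig_poly J"
  shows "q \<in> borel_measurable (\<Pi>\<^sub>M j\<in>J. borel)"
  using assms by induction measurable

lemma trig_poly_bounded:
  assumes "q \<in> trig_poly J"
  shows "\<exists>C. \<forall>x. norm (q x) \<le> C"
  using assms
proof induction
  case (single c a)
  then show ?case by (intro exI[of _ "norm c"]) (simp add: norm_mult)
next
  case (add p q)
  then obtain C D where "\<forall>x. norm (p x) \<le> C" "\<forall>x. norm (q x) \<le> D" by blast
  then show ?case by (intro exI[of _ "C + D"]) (meson add_mono norm_triangle_le)
qed

section \<open>Uniform approximation by trigonometric polynomials on boxes\<close>

text \<open>Carries vectors indexed by codes back to \<open>J\<close>, to be used with a multiple of
  arcsin as \<open>h\<close>. Off \<open>J\<close> the coordinate is constantly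
  \<open>undefined\<close>, hence continuous.\<close>

lemma continuous_on_restrict_fun:
  fixes h :: "real \<Rightarrow> real"
  assumes "continuous_on A h"
  shows "continuous_on (PiE (e ` J) (\<lambda>_. A)) (\<lambda>u. \<lambda>j\<in>J. h (u (e j)))"
proof (rule continuous_on_coordinatewise_then_product)
  fix j
  show "continuous_on (PiE (e ` J) (\<lambda>_. A)) (\<lambda>u. (\<lambda>j\<in>J. h (u (e j))) j)"
  proof (cases "j \<in> J")
    case True
    have "continuous_on (PiE (e ` J) (\<lambda>_. A)) (\<lambda>u. h (u (e j)))"
      by (rule continuous_on_compose2[OF assms])
         (use True in \<open>auto intro: continuous_on_product_coordinates continuous_on_subset\<close>)
    then show ?thesis using True by simp
  qed (simp add: continuous_on_const)
qed

text \<open>Extensionality means a singleton factor \<open>{undefined}\<close> off \<open>J\<close>,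
  so this is Tychonoff's theorem in the full function space.\<close>

lemma compact_PiE_UNIV:
  fixes S :: "'a::topological_space set"
  assumes "compact S"
  shows "compact (PiE J (\<lambda>_. S))"
proof -
  have eq: "PiE J (\<lambda>_. S) = PiE UNIV (\<lambda>j. if j \<in> J then S else {undefined})"
    by (auto simp: PiE_iff extensional_def split: if_splits)
  have "compactin (product_topology (\<lambda>_. euclidean) UNIV)
      (PiE UNIV (\<lambda>j. if j \<in> J then S else {undefined}))"
    unfolding compactin_PiE using assms by (auto simp: compactin_euclidean_iff)
  then show ?thesis unfolding eq euclidean_product_topology compactin_euclidean_iff .
qed

text \<open>Approximating by polynomials in \<open>sin (x j / L)\<close>, rather than directly by trigonometric
  polynomials on the box, makes the approximation bounded outside the box too. The function space
  over an arbitrary index type is not an instance of the class of Hausdorff spaces, which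
  is why \<open>J\<close> is reindexed by \<open>e\<close> with natural numbers.\<close>

lemma trig_poly_approximation:
  fixes \<phi> :: "('s \<Rightarrow> real) \<Rightarrow> real"
  assumes J: "finite J" and \<phi>: "continuous_on (PiE J (\<lambda>_. UNIV)) \<phi>" and "0 < B" "0 < \<epsilon>"
  obtains q where "q \<in> trig_poly J"
    and "\<And>x. x \<in> PiE J (\<lambda>_. {-B..B}) \<Longrightarrow> norm (q x - \<phi> x) \<le> \<epsilon>"
    and "\<And>x. \<exists>y\<in>PiE J (\<lambda>_. UNIV). norm (q x - \<phi> y) \<le> \<epsilon>"
proof -
  obtain e :: "'s \<Rightarrow> nat" where e: "inj_on e J"
    using finite_imp_inj_to_nat_seg[OF J] by blast
  \<comment> \<open>With this \<open>L\<close>, the box |x j| \<le> B is mapped by x j / L into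
    [-pi/2, pi/2], where arcsin inverts sin.\<close>
  define L where "L = 2 * B / pi"
  have L: "0 < L" using \<open>0 < B\<close> by (simp add: L_def)
  let ?S = "PiE (e ` J) (\<lambda>_. {-1..1::real})"
  define \<psi> where "\<psi> u = \<phi> (\<lambda>j\<in>J. L * arcsin (u (e j)))" for u
  define sn where "sn x = (\<lambda>k\<in>e ` J. sin (x (inv_into J e k) / L))" for x :: "'s \<Rightarrow> real"
  have sn_e: "sn x (e j) = sin (x j / L)" if "j \<in> J" for x j
    using that e by (simp add: sn_def)
  \<comment> \<open>The algebra for Stone-Weierstrass: continuous functions on the cube that turn
    into trigonometric polynomials after the substitution \<open>sn\<close>.\<close>
  define R where "R g \<longleftrightarrow> continuous_on ?S g \<and>
      (\<exists>q\<in>trig_poly J. \<forall>x. complex_of_real (g (sn x)) = q x)" for g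
  have "\<exists>g. R g \<and> (\<forall>u\<in>?S. \<bar>\<psi> u - g u\<bar> < \<epsilon>)"
  proof (rule Stone_Weierstrass_HOL[where P = R])
    show "compact ?S" by (simp add: compact_PiE_UNIV)
    show "R (\<lambda>_. c)" for c unfolding R_def using trig_poly_const by fastforce
    show "R (\<lambda>u. g u + h u)" if gh: "R g \<and> R h" for g h
    proof -
      obtain p q where "p \<in> trig_poly J" "\<forall>x. complex_of_real (g (sn x)) = p x"
        "q \<in> trig_poly J" "\<forall>x. complex_of_real (h (sn x)) = q x"
        using gh unfolding R_def by blast
      then show ?thesis using gh unfolding R_def
        by (auto intro!: continuous_on_add bexI[of _ "\<lambda>x. p x + q x"] trig_poly.add)
    qed
    show "R (\<lambda>u. g u * h u)" if gh: "R g \<and> R h" for g h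
    proof -
      obtain p q where "p \<in> trig_poly J" "\<forall>x. complex_of_real (g (sn x)) = p x"
        "q \<in> trig_poly J" "\<forall>x. complex_of_real (h (sn x)) = q x"
        using gh unfolding R_def by blast
      then show ?thesis using gh unfolding R_def
        by (auto intro!: continuous_on_mult bexI[of _ "\<lambda>x. p x * q x"] trig_poly_mult)
    qed
    show "continuous_on ?S g" if "R g" for g using that by (simp add: R_def)
    show "\<exists>g. R g \<and> g u \<noteq> g v" if uv: "u \<in> ?S \<and> v \<in> ?S \<and> u \<noteq> v" for u v
    proof -
      obtain j where j: "j \<in> J" "u (e j) \<noteq> v (e j)" using PiE_ext[of u "e ` J" "\<lambda>_. {-1..1}" v] uv by blast
      have "continuous_on ?S (\<lambda>u. u (e j))"
        by (rule continuous_on_subset[OF continuous_on_product_coordinates subset_UNIV])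
      then have "R (\<lambda>u. u (e j))" unfolding R_def
        using bexI[OF _ trig_poly_sin[OF J j(1), of "1 / L"]] j(1) by (simp add: sn_e)
      then show ?thesis using j by blast
    qed
    show "continuous_on ?S \<psi>" unfolding \<psi>_def
    proof (rule continuous_on_compose2[OF \<phi>])
      show "continuous_on ?S (\<lambda>u. \<lambda>j\<in>J. L * arcsin (u (e j)))"
        by (intro continuous_on_restrict_fun continuous_intros) auto
    qed auto
    show "0 < \<epsilon>" by fact
  qed
  then obtain g where "R g" and g: "\<And>u. u \<in> ?S \<Longrightarrow> \<bar>\<psi> u - g u\<bar> < \<epsilon>" by auto
  then obtain q where q: "q \<in> trig_poly J" "\<And>x. complex_of_real (g (sn x)) = q x"
    unfolding R_def by auto
  \<comment> \<open>Valid for every \<open>x\<close>: the map L * arcsin (sin (x j / L)) folds the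
    line onto [-B, B] and fixes the points of that interval. So \<open>q\<close> is near a value of
    \<phi> everywhere, and near \<phi> x inside the box.\<close>
  have approx: "norm (q x - \<phi> (\<lambda>j\<in>J. L * arcsin (sin (x j / L)))) \<le> \<epsilon>" for x
  proof -
    have S: "sn x \<in> ?S" by (auto simp: sn_def)
    have "(\<lambda>j\<in>J. L * arcsin (sin (x j / L))) = (\<lambda>j\<in>J. L * arcsin (sn x (e j)))"
      by (auto simp: sn_e)
    then show ?thesis using g[OF S]
      unfolding \<psi>_def q(2)[symmetric] of_real_diff[symmetric] norm_of_real
      by (simp add: abs_minus_commute)
  qed
  show ?thesis
  proof (rule that[OF q(1)])
    show "\<exists>y\<in>PiE J (\<lambda>_. UNIV). norm (q x - \<phi> y) \<le> \<epsilon>" for x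
      using approx by (rule bexI[where x = "\<lambda>j\<in>J. L * arcsin (sin (x j / L))"]) auto
    fix x assume x: "x \<in> PiE J (\<lambda>_. {-B..B})"
    have "(\<lambda>j\<in>J. L * arcsin (sin (x j / L))) = x"
    proof
      fix j
      show "(\<lambda>j\<in>J. L * arcsin (sin (x j / L))) j = x j"
      proof (cases "j \<in> J")
        case True
        then have "-B \<le> x j" "x j \<le> B" using x by (auto simp: PiE_iff)
        then have "- (pi/2) \<le> x j / L" "x j / L \<le> pi/2"
          using \<open>0 < B\<close> mult_left_mono[of "- B" "x j" pi] mult_left_mono[of "x j" B pi]
          by (auto simp: L_def field_simps)
        then show ?thesis using True L by (simp add: arcsin_sin)
      next
        case False
        then show ?thesis using x by (auto simp: PiE_iff extensional_def)
      qed
    qed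
    then show "norm (q x - \<phi> x) \<le> \<epsilon>" using approx[of x] by simp
  qed
qed

text \<open>On the extensional functions \<phi> is the pointwise limit of trigonometric polynomials
  that are accurate to 1/(n+1) on the box of half-width n+1; each point lies in all but finitely
  many of these boxes.\<close>

lemma continuous_on_PiE_measurable:
  fixes \<phi> :: "('s \<Rightarrow> real) \<Rightarrow> real"
  assumes J: "finite J" and \<phi>: "continuous_on (PiE J (\<lambda>_. UNIV)) \<phi>"
  shows "\<phi> \<in> borel_measurable (\<Pi>\<^sub>M j\<in>J. borel)"
proof -
  have "\<exists>q. q \<in> trig_poly J \<and> (\<forall>x\<in>PiE J (\<lambda>_. {- real (Suc n)..real (Suc n)}). norm (q x - \<phi> x) \<le> 1 / real (Suc n))" for n
    by (rule trig_poly_approximation[OF J \<phi>, of "real (Suc n)" "1 / real (Suc n)"]) auto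
  then obtain q where q: "\<And>n. q n \<in> trig_poly J"
      "\<And>n x. x \<in> PiE J (\<lambda>_. {- real (Suc n)..real (Suc n)}) \<Longrightarrow> norm (q n x - \<phi> x) \<le> 1 / real (Suc n)"
    by metis
  show ?thesis
  proof (rule borel_measurable_LIMSEQ_real)
    show "(\<lambda>x. Re (q n x)) \<in> borel_measurable (\<Pi>\<^sub>M j\<in>J. borel)" for n
      using trig_poly_measurable[OF q(1)] by measurable
    fix x :: "'s \<Rightarrow> real" assume "x \<in> space (\<Pi>\<^sub>M j\<in>J. borel)"
    then have x: "x \<in> extensional J" by (auto simp: space_PiM PiE_iff)
    obtain N where N: "\<And>j. j \<in> J \<Longrightarrow> \<bar>x j\<bar> \<le> real N"
    proof -
      obtain N where "(\<Sum>j\<in>J. \<bar>x j\<bar>) \<le> real N" using real_arch_simple by blast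
      then show ?thesis using that[of N] J member_le_sum[of _ J "\<lambda>j. \<bar>x j\<bar>"] by force
    qed
    show "(\<lambda>n. Re (q n x)) \<longlonglongrightarrow> \<phi> x"
    proof (rule Lim_transform_eventually[OF _ always_eventually], rule LIM_zero_cancel, rule Lim_null_comparison)
      show "eventually (\<lambda>n. norm (Re (q n x) - \<phi> x) \<le> 1 / real (Suc n)) sequentially"
        using eventually_ge_at_top[of N]
      proof eventually_elim
        case (elim n)
        have "x \<in> PiE J (\<lambda>_. {- real (Suc n)..real (Suc n)})"
          using x N elim by (force simp: PiE_iff abs_le_iff)
        from q(2)[OF this] have "norm (Re (q n x - \<phi> x)) \<le> 1 / real (Suc n)"
          using abs_Re_le_cmod order_trans by (metis real_norm_def)
        then show ?case by simp
      qed
      show "(\<lambda>n. 1 / real (Suc n)) \<longlonglongrightarrow> 0" by (rule LIMSEQ_Suc[OF lim_1_over_n])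
    qed auto
  qed
qed

section \<open>Levy continuity in several dimensions\<close>

lemma integrable_trig_poly:
  assumes M: "prob_space M" and p: "p \<in> trig_poly J" and W: "\<And>j. j \<in> J \<Longrightarrow> W j \<in> borel_measurable M"
  shows "integrable M (\<lambda>w. p (\<lambda>j\<in>J. W j w))"
proof -
  interpret prob_space M by (rule M)
  obtain C where "\<forall>x. norm (p x) \<le> C" using trig_poly_bounded[OF p] by blast
  moreover have "(\<lambda>w. p (\<lambda>j\<in>J. W j w)) \<in> borel_measurable M"
    by (rule measurable_compose[OF measurable_restrict trig_poly_measurable[OF p]]) (rule W)
  ultimately show ?thesis by (intro integrable_const_bound[of _ C]) auto
qed

lemma integral_trig_poly_tendsto:
  assumes P: "prob_space P" "prob_space Q"
    and Y: "\<And>n s. s \<in> J \<Longrightarrow> Y n s \<in> borel_measurable P" and Z: "\<And>s. s \<in> J \<Longrightarrow> Z s \<in> borel_measurable Q"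
    and conv: "\<And>a. (\<lambda>n. \<integral>w. iexp (\<Sum>j\<in>J. a j * Y n j w) \<partial>P) \<longlonglongrightarrow> (\<integral>w. iexp (\<Sum>j\<in>J. a j * Z j w) \<partial>Q)"
    and q: "q \<in> trig_poly J"
  shows "(\<lambda>n. \<integral>w. q (\<lambda>j\<in>J. Y n j w) \<partial>P) \<longlonglongrightarrow> (\<integral>w. q (\<lambda>j\<in>J. Z j w) \<partial>Q)"
  using q
proof induction
  case (single c a)
  have *: "(\<Sum>j\<in>J. a j * (\<lambda>j\<in>J. y j) j) = (\<Sum>j\<in>J. a j * y j)" for y by (rule sum.cong) auto
  show ?case unfolding * integral_mult_right_zero by (intro tendsto_mult_left conv)
next
  case (add p q)
  have "(\<integral>w. p (\<lambda>j\<in>J. Y n j w) + q (\<lambda>j\<in>J. Y n j w) \<partial>P) =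
      (\<integral>w. p (\<lambda>j\<in>J. Y n j w) \<partial>P) + (\<integral>w. q (\<lambda>j\<in>J. Y n j w) \<partial>P)" for n
    by (intro Bochner_Integration.integral_add integrable_trig_poly add.hyps P(1) Y)
  moreover have "(\<integral>w. p (\<lambda>j\<in>J. Z j w) + q (\<lambda>j\<in>J. Z j w) \<partial>Q) =
      (\<integral>w. p (\<lambda>j\<in>J. Z j w) \<partial>Q) + (\<integral>w. q (\<lambda>j\<in>J. Z j w) \<partial>Q)"
    by (intro Bochner_Integration.integral_add integrable_trig_poly add.hyps P(2) Z)
  ultimately show ?case
    using tendsto_add[OF add.IH] by presburger
qed

text \<open>Expectations of trigonometric polynomials converge by linearity. Replacing \<phi> by
  such a polynomial costs \<epsilon> inside a box and a constant outside it; the outside is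
  dominated by continuous cutoffs of single coordinates, whose expectations converge by the
  one-dimensional theorem.\<close>

theorem fdd_converges_of_char:
  fixes Y :: "nat \<Rightarrow> 's \<Rightarrow> 'w \<Rightarrow> real" and Z :: "'s \<Rightarrow> 'v \<Rightarrow> real"
  assumes P: "prob_space P" and Q: "prob_space Q"
    and Y: "\<And>n s. Y n s \<in> borel_measurable P" and Z: "\<And>s. Z s \<in> borel_measurable Q"
    and conv: "\<And>J a. finite J \<Longrightarrow>
      (\<lambda>n. \<integral>w. iexp (\<Sum>j\<in>J. a j * Y n j w) \<partial>P) \<longlonglongrightarrow> (\<integral>w. iexp (\<Sum>j\<in>J. a j * Z j w) \<partial>Q)"
  shows "fdd_converges P Y Q Z"
  unfolding fdd_converges_def
proof (intro allI impI)
  fix J and \<phi> :: "('s \<Rightarrow> real) \<Rightarrow> real"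
  assume J: "finite J" and \<phi>: "continuous_on (PiE J (\<lambda>_. UNIV)) \<phi>"
    and bdd: "bounded (\<phi> ` PiE J (\<lambda>_. UNIV))"
  interpret P: prob_space P by fact
  interpret Q: prob_space Q by fact
  obtain C where C: "\<And>x. x \<in> PiE J (\<lambda>_. UNIV) \<Longrightarrow> \<bar>\<phi> x\<bar> \<le> C" "0 < C"
    using bdd unfolding bounded_pos by fastforce
  \<comment> \<open>Bounds |q - \<phi>| everywhere: |\<phi>| \<le> C and |q| \<le> C + \<epsilon>
    with \<epsilon> \<le> 1.\<close>
  define K where "K = 2 * C + 1"
  have \<phi>_meas: "\<phi> \<in> borel_measurable (\<Pi>\<^sub>M j\<in>J. borel)"
    by (rule continuous_on_PiE_measurable[OF J \<phi>])
  have Yv: "(\<lambda>w. \<lambda>j\<in>J. Y n j w) \<in> measurable P (\<Pi>\<^sub>M j\<in>J. borel)" for n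
    by (intro measurable_restrict Y)
  have Zv: "(\<lambda>w. \<lambda>j\<in>J. Z j w) \<in> measurable Q (\<Pi>\<^sub>M j\<in>J. borel)"
    by (intro measurable_restrict Z)
  \<comment> \<open>A continuous ramp, 0 for |x| \<le> b+1 and 1 for |x| \<ge> 2(b+1). It dominates
    the indicator of leaving the box of half-width 2(b+1), while its continuity lets weak
    convergence apply.\<close>
  define h where "h b x = min 1 (max 0 (\<bar>x\<bar> / real (Suc b) - 1))" for b :: nat and x :: real
  have h01: "0 \<le> h b x" "h b x \<le> 1" for b x by (auto simp: h_def)
  have h1: "h b x = 1" if "2 * real (Suc b) < \<bar>x\<bar>" for b x
    using that by (simp add: h_def field_simps)
  have h_meas[measurable]: "h b \<in> borel_measurable borel" for b unfolding h_def by measurable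
  have h_lim: "(\<lambda>b. h b x) \<longlonglongrightarrow> 0" for x
  proof (rule tendsto_eventually)
    obtain N where "\<bar>x\<bar> \<le> real N" using real_arch_simple by blast
    show "eventually (\<lambda>b. h b x = 0) sequentially" using eventually_ge_at_top[of N]
    proof eventually_elim
      case (elim b)
      then have "\<bar>x\<bar> \<le> real (Suc b)" using \<open>\<bar>x\<bar> \<le> real N\<close> by linarith
      then show ?case by (simp add: h_def field_simps)
    qed
  qed
  have hY: "(\<lambda>n. \<integral>w. h b (Y n j w) \<partial>P) \<longlonglongrightarrow> (\<integral>w. h b (Z j w) \<partial>Q)" for b j
  proof -
    have char: "char (distr P borel (Y n j)) t = (\<integral>w. iexp (\<Sum>j\<in>{j}. t * Y n j w) \<partial>P)" for n t
      unfolding char_def by (subst integral_distr) (auto intro: Y)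
    have charZ: "char (distr Q borel (Z j)) t = (\<integral>w. iexp (\<Sum>j\<in>{j}. t * Z j w) \<partial>Q)" for t
      unfolding char_def by (subst integral_distr) (auto intro: Z)
    have "weak_conv_m (\<lambda>n. distr P borel (Y n j)) (distr Q borel (Z j))"
    proof (rule levy_continuity)
      show "(\<lambda>n. char (distr P borel (Y n j)) t) \<longlonglongrightarrow> char (distr Q borel (Z j)) t" for t
        unfolding char charZ by (rule conv) simp
    qed (auto intro!: P.real_distribution_distr Q.real_distribution_distr Y Z)
    then have "(\<lambda>n. \<integral>x. h b x \<partial>distr P borel (Y n j)) \<longlonglongrightarrow> (\<integral>x. h b x \<partial>distr Q borel (Z j))"
    proof (rule weak_conv_imp_integral_bdd_continuous_conv[rotated 2])
      show "isCont (h b) x" for x unfolding h_def by (intro continuous_intros) auto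
      show "norm (h b x) \<le> 1" for x using h01[of b x] by simp
    qed (auto intro!: P.real_distribution_distr Q.real_distribution_distr Y Z)
    then show ?thesis
      by (simp add: integral_distr Y Z)
  qed
  have int_h: "integrable P (\<lambda>w. h b (Y n j w))" "integrable Q (\<lambda>w. h b (Z j w))" for b n j
    using Y[of n j] Z[of j] h01
    by (auto intro!: P.integrable_const_bound[of _ 1] Q.integrable_const_bound[of _ 1])
  have int_\<phi>: "integrable P (\<lambda>w. \<phi> (\<lambda>j\<in>J. Y n j w))" "integrable Q (\<lambda>w. \<phi> (\<lambda>j\<in>J. Z j w))" for n
    using measurable_compose[OF Yv \<phi>_meas] measurable_compose[OF Zv \<phi>_meas] C(1)
    by (auto intro!: P.integrable_const_bound[of _ C] Q.integrable_const_bound[of _ C])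
  have "(\<lambda>n. \<integral>w. \<phi> (\<lambda>j\<in>J. Y n j w) \<partial>P) \<longlonglongrightarrow> (\<integral>w. \<phi> (\<lambda>j\<in>J. Z j w) \<partial>Q)"
  proof (rule LIMSEQ_I)
    fix r :: real assume "0 < r"
    \<comment> \<open>Five errors below \<epsilon> or equal to it add up at the end: two
      approximation errors inside the box, two outside, and the difference of the expectations of
      \<open>q\<close>.\<close>
    define \<epsilon> where "\<epsilon> = min 1 (r / 6)"
    have \<epsilon>: "0 < \<epsilon>" "\<epsilon> \<le> 1" "6 * \<epsilon> \<le> r" using \<open>0 < r\<close> by (auto simp: \<epsilon>_def)
    \<comment> \<open>The box is chosen under the limit law alone; by \<open>hY\<close> the same box
      then serves all large n.\<close>
    have "(\<lambda>b. K * (\<Sum>j\<in>J. \<integral>w. h b (Z j w) \<partial>Q)) \<longlonglongrightarrow> K * (\<Sum>j\<in>J. \<integral>w. 0 \<partial>Q)"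
    proof (intro tendsto_intros integral_dominated_convergence[where w = "\<lambda>_. 1"])
      show "AE w in Q. (\<lambda>b. h b (Z j w)) \<longlonglongrightarrow> 0" for j using h_lim by simp
      show "AE w in Q. norm (h b (Z j w)) \<le> 1" for b j using h01 by simp
    qed (use Z in auto)
    then have "eventually (\<lambda>b. K * (\<Sum>j\<in>J. \<integral>w. h b (Z j w) \<partial>Q) < \<epsilon>) sequentially"
      using \<epsilon>(1) by (intro order_tendstoD) auto
    then obtain b where b: "K * (\<Sum>j\<in>J. \<integral>w. h b (Z j w) \<partial>Q) < \<epsilon>"
      by (auto simp: eventually_sequentially)
    obtain q where q: "q \<in> trig_poly J"
      "\<And>x. x \<in> PiE J (\<lambda>_. {- (2 * real (Suc b))..2 * real (Suc b)}) \<Longrightarrow> norm (q x - \<phi> x) \<le> \<epsilon>"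
      "\<And>x. \<exists>y\<in>PiE J (\<lambda>_. UNIV). norm (q x - \<phi> y) \<le> \<epsilon>"
      using trig_poly_approximation[OF J \<phi>, of "2 * real (Suc b)" \<epsilon>] \<epsilon>(1) by auto
    have q_bd: "norm (q x) \<le> C + \<epsilon>" for x
    proof -
      obtain y where y: "y \<in> PiE J (\<lambda>_. UNIV)" "norm (q x - \<phi> y) \<le> \<epsilon>" using q(3) by blast
      have "norm (q x) \<le> norm (complex_of_real (\<phi> y)) + norm (q x - \<phi> y)"
        by (rule norm_triangle_sub)
      then show ?thesis using C(1)[OF y(1)] y(2) by simp
    qed
    have q_diff: "norm (q x - \<phi> x) \<le> \<epsilon> + K * (\<Sum>j\<in>J. h b (x j))" if x: "x \<in> PiE J (\<lambda>_. UNIV)" for x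
    proof (cases "\<forall>j\<in>J. \<bar>x j\<bar> \<le> 2 * real (Suc b)")
      case True
      then have "x \<in> PiE J (\<lambda>_. {- (2 * real (Suc b))..2 * real (Suc b)})"
        using x by (auto simp: PiE_iff abs_le_iff)
      from q(2)[OF this] have "norm (q x - \<phi> x) \<le> \<epsilon>" .
      moreover have "0 \<le> K * (\<Sum>j\<in>J. h b (x j))"
        by (intro mult_nonneg_nonneg sum_nonneg h01) (use C(2) in \<open>simp add: K_def\<close>)
      ultimately show ?thesis by linarith
    next
      case False
      then obtain j where j: "j \<in> J" "2 * real (Suc b) < \<bar>x j\<bar>" by force
      have "1 \<le> (\<Sum>j\<in>J. h b (x j))"
        using member_le_sum[of j J "\<lambda>j. h b (x j)"] J j h01 h1[of b "x j"] by simp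
      then have "K \<le> K * (\<Sum>j\<in>J. h b (x j))" using C(2) by (simp add: K_def)
      moreover have "norm (q x - \<phi> x) \<le> norm (q x) + norm (complex_of_real (\<phi> x))"
        by (rule norm_triangle_ineq4)
      ultimately show ?thesis using q_bd[of x] C(1)[OF x] \<epsilon> by (simp add: K_def)
    qed
    \<comment> \<open>Stated over an arbitrary probability space because it is applied both to
      \<open>P\<close> with \<open>Y n\<close> and to \<open>Q\<close> with
      \<open>Z\<close>.\<close>
    have approx: "integrable M (\<lambda>w. q (\<lambda>j\<in>J. W j w)) \<and>
      norm ((\<integral>w. q (\<lambda>j\<in>J. W j w) \<partial>M) - complex_of_real (\<integral>w. \<phi> (\<lambda>j\<in>J. W j w) \<partial>M)) \<le> \<epsilon> + K * (\<Sum>j\<in>J. \<integral>w. h b (W j w) \<partial>M)"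
      if M: "prob_space M" and W: "(\<lambda>w. \<lambda>j\<in>J. W j w) \<in> measurable M (\<Pi>\<^sub>M j\<in>J. borel)"
        and i1: "\<And>j. integrable M (\<lambda>w. h b (W j w))" and i2: "integrable M (\<lambda>w. \<phi> (\<lambda>j\<in>J. W j w))"
      for M :: "'z measure" and W
    proof -
      interpret prob_space M by (rule M)
      have int: "integrable M (\<lambda>w. q (\<lambda>j\<in>J. W j w))"
        using measurable_compose[OF W trig_poly_measurable[OF q(1)]] q_bd
        by (intro integrable_const_bound[of _ "C + \<epsilon>"]) auto
      have "norm ((\<integral>w. q (\<lambda>j\<in>J. W j w) \<partial>M) - complex_of_real (\<integral>w. \<phi> (\<lambda>j\<in>J. W j w) \<partial>M))
         = norm (\<integral>w. q (\<lambda>j\<in>J. W j w) - \<phi> (\<lambda>j\<in>J. W j w) \<partial>M)"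
        using int i2 by (simp add: integral_complex_of_real)
      also have "\<dots> \<le> (\<integral>w. norm (q (\<lambda>j\<in>J. W j w) - \<phi> (\<lambda>j\<in>J. W j w)) \<partial>M)"
        by (rule integral_norm_bound)
      also have "\<dots> \<le> (\<integral>w. \<epsilon> + K * (\<Sum>j\<in>J. h b (W j w)) \<partial>M)"
      proof (rule integral_mono)
        show "norm (q (\<lambda>j\<in>J. W j w) - \<phi> (\<lambda>j\<in>J. W j w)) \<le> \<epsilon> + K * (\<Sum>j\<in>J. h b (W j w))" for w
          using q_diff[of "\<lambda>j\<in>J. W j w"] by simp
      qed (use int i1 i2 in \<open>auto intro!: integrable_norm Bochner_Integration.integrable_diff\<close>)
      also have "\<dots> = \<epsilon> + K * (\<Sum>j\<in>J. \<integral>w. h b (W j w) \<partial>M)"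
        using i1 by (simp add: prob_space)
      finally show ?thesis using int by blast
    qed
    let ?D = "\<lambda>n. K * (\<Sum>j\<in>J. \<integral>w. h b (Y n j w) \<partial>P)"
    have D: "?D \<longlonglongrightarrow> K * (\<Sum>j\<in>J. \<integral>w. h b (Z j w) \<partial>Q)"
      by (intro tendsto_intros hY)
    have E1: "eventually (\<lambda>n. ?D n < \<epsilon>) sequentially" using D b by (rule order_tendstoD)
    have "(\<lambda>n. \<integral>w. q (\<lambda>j\<in>J. Y n j w) \<partial>P) \<longlonglongrightarrow> (\<integral>w. q (\<lambda>j\<in>J. Z j w) \<partial>Q)"
      by (intro integral_trig_poly_tendsto P Q Y Z conv J q(1))
    then have E2: "eventually (\<lambda>n. norm ((\<integral>w. q (\<lambda>j\<in>J. Y n j w) \<partial>P) - (\<integral>w. q (\<lambda>j\<in>J. Z j w) \<partial>Q)) < \<epsilon>) sequentially"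
      using \<epsilon>(1) by (auto simp: tendsto_iff dist_norm)
    from E1 E2 have "eventually (\<lambda>n. norm ((\<integral>w. \<phi> (\<lambda>j\<in>J. Y n j w) \<partial>P) - (\<integral>w. \<phi> (\<lambda>j\<in>J. Z j w) \<partial>Q)) < r) sequentially"
    proof eventually_elim
      case (elim n)
      let ?y = "\<integral>w. \<phi> (\<lambda>j\<in>J. Y n j w) \<partial>P" and ?z = "\<integral>w. \<phi> (\<lambda>j\<in>J. Z j w) \<partial>Q"
      let ?u = "\<integral>w. q (\<lambda>j\<in>J. Y n j w) \<partial>P" and ?v = "\<integral>w. q (\<lambda>j\<in>J. Z j w) \<partial>Q"
      have "norm (?u - complex_of_real ?y) \<le> \<epsilon> + ?D n"
        using approx[OF P Yv int_h(1) int_\<phi>(1)] by blast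
      moreover have "norm (?v - complex_of_real ?z) \<le> \<epsilon> + K * (\<Sum>j\<in>J. \<integral>w. h b (Z j w) \<partial>Q)"
        using approx[OF Q Zv int_h(2) int_\<phi>(2)] by blast
      moreover have "norm (complex_of_real ?y - complex_of_real ?z) \<le>
        norm (?u - complex_of_real ?y) + norm (?v - complex_of_real ?z) + norm (?u - ?v)"
        using norm_triangle_ineq4[of "?u - ?v" "?u - complex_of_real ?y"]
          norm_triangle_ineq[of "?u - ?v - (?u - complex_of_real ?y)" "?v - complex_of_real ?z"]
        by (simp add: algebra_simps)
      moreover have "norm (complex_of_real ?y - complex_of_real ?z) = norm (?y - ?z)"
        by (simp only: of_real_diff[symmetric] norm_of_real real_norm_def)
      ultimately show ?case using elim b \<epsilon> by linarith
    qed
    then show "\<exists>N. \<forall>n\<ge>N. norm ((\<integral>w. \<phi> (\<lambda>j\<in>J. Y n j w) \<partial>P) - (\<integral>w. \<phi> (\<lambda>j\<in>J. Z j w) \<partial>Q)) < r"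
      by (simp add: eventually_sequentially)
  qed
  then show "(\<lambda>n. \<integral>y. \<phi> y \<partial>fdd P (Y n) J) \<longlonglongrightarrow> (\<integral>y. \<phi> y \<partial>fdd Q Z J)"
    unfolding fdd_def by (simp add: integral_distr[OF Yv \<phi>_meas] integral_distr[OF Zv \<phi>_meas])
qed

section \<open>Stable integrals\<close>

text \<open>Either |b| \<le> \<delta> |a|, and the first term suffices, or |a| < |b| / \<delta>, and
  the second does. This replaces Minkowski's inequality; the coefficient of |a|^\<alpha> tends to 1
  as \<delta> tends to 0, at the price of a large coefficient of |b|^\<alpha>.\<close>

lemma abs_add_powr_le:
  fixes a b :: real
  assumes "0 < \<alpha>" "0 < \<delta>"
  shows "\<bar>a + b\<bar> powr \<alpha> \<le> (1 + \<delta>) powr \<alpha> * \<bar>a\<bar> powr \<alpha> + (1 + 1 / \<delta>) powr \<alpha> * \<bar>b\<bar> powr \<alpha>"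
proof (cases "\<bar>b\<bar> \<le> \<delta> * \<bar>a\<bar>")
  case True
  then have "\<bar>a + b\<bar> \<le> (1 + \<delta>) * \<bar>a\<bar>" by (simp add: distrib_right)
  then have "\<bar>a + b\<bar> powr \<alpha> \<le> ((1 + \<delta>) * \<bar>a\<bar>) powr \<alpha>"
    using assms by (intro powr_mono2) auto
  also have "\<dots> = (1 + \<delta>) powr \<alpha> * \<bar>a\<bar> powr \<alpha>" using assms by (simp add: powr_mult)
  also have "\<dots> \<le> \<dots> + (1 + 1 / \<delta>) powr \<alpha> * \<bar>b\<bar> powr \<alpha>" by simp
  finally show ?thesis .
next
  case False
  then have "\<bar>a\<bar> \<le> (1 / \<delta>) * \<bar>b\<bar>" using assms by (simp add: field_simps)
  then have "\<bar>a + b\<bar> \<le> (1 + 1 / \<delta>) * \<bar>b\<bar>" by (simp add: distrib_right)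
  then have "\<bar>a + b\<bar> powr \<alpha> \<le> ((1 + 1 / \<delta>) * \<bar>b\<bar>) powr \<alpha>"
    using assms by (intro powr_mono2) auto
  also have "\<dots> = (1 + 1 / \<delta>) powr \<alpha> * \<bar>b\<bar> powr \<alpha>" using assms by (simp add: powr_mult)
  also have "\<dots> \<le> (1 + \<delta>) powr \<alpha> * \<bar>a\<bar> powr \<alpha> + \<dots>" by simp
  finally show ?thesis .
qed

lemma L_alpha_scale_add:
  assumes \<alpha>: "0 < \<alpha>" and f: "f \<in> L_alpha \<alpha> m" and g: "g \<in> L_alpha \<alpha> m"
  shows "(\<lambda>x. a * f x + g x) \<in> L_alpha \<alpha> m"
    and "(\<integral>x. \<bar>a * f x + g x\<bar> powr \<alpha> \<partial>m) \<le>
      2 powr \<alpha> * \<bar>a\<bar> powr \<alpha> * (\<integral>x. \<bar>f x\<bar> powr \<alpha> \<partial>m) + 2 powr \<alpha> * (\<integral>x. \<bar>g x\<bar> powr \<alpha> \<partial>m)"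
proof -
  have [measurable]: "f \<in> borel_measurable m" "g \<in> borel_measurable m"
    and int: "integrable m (\<lambda>x. \<bar>f x\<bar> powr \<alpha>)" "integrable m (\<lambda>x. \<bar>g x\<bar> powr \<alpha>)"
    using f g by (auto simp: L_alpha_def)
  have le: "\<bar>a * f x + g x\<bar> powr \<alpha> \<le>
      2 powr \<alpha> * \<bar>a\<bar> powr \<alpha> * \<bar>f x\<bar> powr \<alpha> + 2 powr \<alpha> * \<bar>g x\<bar> powr \<alpha>" for x
    using abs_add_powr_le[OF \<alpha>, of 1 "a * f x" "g x"] by (simp add: abs_mult powr_mult)
  have int': "integrable m (\<lambda>x. 2 powr \<alpha> * \<bar>a\<bar> powr \<alpha> * \<bar>f x\<bar> powr \<alpha> + 2 powr \<alpha> * \<bar>g x\<bar> powr \<alpha>)"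
    using int by simp
  have int'': "integrable m (\<lambda>x. \<bar>a * f x + g x\<bar> powr \<alpha>)"
    by (rule Bochner_Integration.integrable_bound[OF int']) (use le in \<open>auto intro!: AE_I2\<close>)
  then show "(\<lambda>x. a * f x + g x) \<in> L_alpha \<alpha> m" by (simp add: L_alpha_def)
  show "(\<integral>x. \<bar>a * f x + g x\<bar> powr \<alpha> \<partial>m) \<le>
      2 powr \<alpha> * \<bar>a\<bar> powr \<alpha> * (\<integral>x. \<bar>f x\<bar> powr \<alpha> \<partial>m) + 2 powr \<alpha> * (\<integral>x. \<bar>g x\<bar> powr \<alpha> \<partial>m)"
    using integral_mono[OF int'' int' le] int by simp
qed

lemma L_alpha_diff:
  assumes "0 < \<alpha>" "f \<in> L_alpha \<alpha> m" "g \<in> L_alpha \<alpha> m"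
  shows "(\<lambda>x. f x - g x) \<in> L_alpha \<alpha> m"
  using L_alpha_scale_add(1)[OF assms(1,3,2), of "-1"] by simp

text \<open>The inequality is applied in both directions. For fixed \<delta> the large coefficient
  multiplies a quantity tending to 0; only afterwards is \<delta> taken so small that the other
  coefficient is near 1.\<close>

lemma integral_abs_powr_tendsto:
  assumes \<alpha>: "0 < \<alpha>" and f: "f \<in> L_alpha \<alpha> m" and g: "\<And>n. g n \<in> L_alpha \<alpha> m"
    and lim: "(\<lambda>n. \<integral>x. \<bar>g n x - f x\<bar> powr \<alpha> \<partial>m) \<longlonglongrightarrow> 0"
  shows "(\<lambda>n. \<integral>x. \<bar>g n x\<bar> powr \<alpha> \<partial>m) \<longlonglongrightarrow> (\<integral>x. \<bar>f x\<bar> powr \<alpha> \<partial>m)"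
proof -
  define F where "F = (\<integral>x. \<bar>f x\<bar> powr \<alpha> \<partial>m)"
  define G where "G n = (\<integral>x. \<bar>g n x\<bar> powr \<alpha> \<partial>m)" for n
  define D where "D n = (\<integral>x. \<bar>g n x - f x\<bar> powr \<alpha> \<partial>m)" for n
  define c where "c \<delta> = (1 + \<delta>) powr \<alpha>" for \<delta>
  have int: "integrable m (\<lambda>x. \<bar>f x\<bar> powr \<alpha>)" "integrable m (\<lambda>x. \<bar>g n x\<bar> powr \<alpha>)"
      "integrable m (\<lambda>x. \<bar>g n x - f x\<bar> powr \<alpha>)" for n
    using f g[of n] L_alpha_diff[OF \<alpha> g[of n] f] by (auto simp: L_alpha_def)
  have F: "0 \<le> F" unfolding F_def by (rule integral_nonneg_AE) simp
  have upper: "G n \<le> c \<delta> * F + c (1 / \<delta>) * D n" if "0 < \<delta>" for n \<delta>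
  proof -
    have "G n \<le> (\<integral>x. c \<delta> * \<bar>f x\<bar> powr \<alpha> + c (1 / \<delta>) * \<bar>g n x - f x\<bar> powr \<alpha> \<partial>m)"
      unfolding G_def c_def
    proof (rule integral_mono)
      fix x show "\<bar>g n x\<bar> powr \<alpha> \<le> (1 + \<delta>) powr \<alpha> * \<bar>f x\<bar> powr \<alpha> + (1 + 1 / \<delta>) powr \<alpha> * \<bar>g n x - f x\<bar> powr \<alpha>"
        using abs_add_powr_le[OF \<alpha> that, of "f x" "g n x - f x"] by simp
    qed (use int in auto)
    then show ?thesis using int by (simp add: F_def D_def)
  qed
  have lower: "F \<le> c \<delta> * G n + c (1 / \<delta>) * D n" if "0 < \<delta>" for n \<delta>
  proof -
    have "F \<le> (\<integral>x. c \<delta> * \<bar>g n x\<bar> powr \<alpha> + c (1 / \<delta>) * \<bar>g n x - f x\<bar> powr \<alpha> \<partial>m)"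
      unfolding F_def c_def
    proof (rule integral_mono)
      fix x show "\<bar>f x\<bar> powr \<alpha> \<le> (1 + \<delta>) powr \<alpha> * \<bar>g n x\<bar> powr \<alpha> + (1 + 1 / \<delta>) powr \<alpha> * \<bar>g n x - f x\<bar> powr \<alpha>"
        using abs_add_powr_le[OF \<alpha> that, of "g n x" "f x - g n x"] by (simp add: abs_minus_commute)
    qed (use int in auto)
    then show ?thesis using int by (simp add: G_def D_def)
  qed
  have c: "(c \<longlongrightarrow> 1) (at_right 0)"
  proof -
    have "((\<lambda>\<delta>::real. (1 + \<delta>) powr \<alpha>) \<longlongrightarrow> (1 + 0) powr \<alpha>) (at_right 0)"
      by (intro tendsto_intros) auto
    then show ?thesis by (simp add: c_def[abs_def])
  qed
  have cpos: "0 < c \<delta>" if "0 < \<delta>" for \<delta> using that by (simp add: c_def)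
  have D: "D \<longlonglongrightarrow> 0" using lim by (simp add: D_def[abs_def])
  have "G \<longlonglongrightarrow> F"
  proof (rule order_tendstoI)
    fix a assume a: "F < a"
    have "((\<lambda>\<delta>. c \<delta> * F) \<longlongrightarrow> 1 * F) (at_right 0)" by (intro tendsto_intros c)
    then have "eventually (\<lambda>\<delta>. c \<delta> * F < a) (at_right 0)" using a by (intro order_tendstoD) auto
    then obtain \<delta> where \<delta>: "0 < \<delta>" "c \<delta> * F < a"
      using eventually_happens'[OF trivial_limit_at_right_real eventually_conj[OF eventually_at_right_less]]
      by blast
    have "(\<lambda>n. c \<delta> * F + c (1 / \<delta>) * D n) \<longlonglongrightarrow> c \<delta> * F + c (1 / \<delta>) * 0" by (intro tendsto_intros D)
    then have "eventually (\<lambda>n. c \<delta> * F + c (1 / \<delta>) * D n < a) sequentially"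
      using \<delta> by (intro order_tendstoD) auto
    then show "eventually (\<lambda>n. G n < a) sequentially"
      by eventually_elim (use upper[OF \<delta>(1)] in \<open>meson le_less_trans\<close>)
  next
    \<comment> \<open>Here \<delta> is chosen with c \<delta> * a < F, so that c \<delta> cancels at
      the end whatever the sign of \<open>a\<close>.\<close>
    fix a assume a: "a < F"
    have "((\<lambda>\<delta>. c \<delta> * a) \<longlongrightarrow> 1 * a) (at_right 0)" by (intro tendsto_intros c)
    then have "eventually (\<lambda>\<delta>. c \<delta> * a < F) (at_right 0)" using a by (intro order_tendstoD) auto
    then obtain \<delta> where \<delta>: "0 < \<delta>" "c \<delta> * a < F"
      using eventually_happens'[OF trivial_limit_at_right_real eventually_conj[OF eventually_at_right_less]]
      by blast
    have "(\<lambda>n. c \<delta> * a + c (1 / \<delta>) * D n) \<longlonglongrightarrow> c \<delta> * a + c (1 / \<delta>) * 0" by (intro tendsto_intros D)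
    then have "eventually (\<lambda>n. c \<delta> * a + c (1 / \<delta>) * D n < F) sequentially"
      using \<delta> by (intro order_tendstoD) auto
    then show "eventually (\<lambda>n. a < G n) sequentially"
    proof eventually_elim
      case (elim n)
      then have "c \<delta> * a < c \<delta> * G n" using lower[OF \<delta>(1), of n] by simp
      then show ?case using cpos[OF \<delta>(1)] by simp
    qed
  qed
  then show ?thesis by (simp add: G_def[abs_def] F_def)
qed

section \<open>Convergence in probability\<close>

text \<open>\<open>W n\<close> equals the combination only almost everywhere, since simple integrals
  are linear only in that sense.\<close>

lemma converges_in_probability_scale_add:
  assumes Q: "prob_space Q"
    and [measurable]: "\<And>n. Y n \<in> borel_measurable Q" "Y' \<in> borel_measurable Q"
      "\<And>n. Z n \<in> borel_measurable Q" "Z' \<in> borel_measurable Q" "\<And>n. W n \<in> borel_measurable Q"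
    and Y: "converges_in_probability Q Y Y'" and Z: "converges_in_probability Q Z Z'"
    and W: "\<And>n. AE w in Q. W n w = a * Y n w + Z n w"
  shows "converges_in_probability Q W (\<lambda>w. a * Y' w + Z' w)"
  unfolding converges_in_probability_def
proof (intro allI impI)
  fix \<epsilon> :: real assume "0 < \<epsilon>"
  interpret prob_space Q by (rule Q)
  \<comment> \<open>Half of \<epsilon> goes to each summand; |a| + 1 keeps the divisor positive for
    a = 0.\<close>
  define d where "d = \<epsilon> / (2 * (\<bar>a\<bar> + 1))"
  have d: "0 < d" "(\<bar>a\<bar> + 1) * d = \<epsilon> / 2" using \<open>0 < \<epsilon>\<close> by (auto simp: d_def field_simps)
  let ?A = "\<lambda>n. {w \<in> space Q. \<bar>Y n w - Y' w\<bar> > d}"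
  let ?B = "\<lambda>n. {w \<in> space Q. \<bar>Z n w - Z' w\<bar> > \<epsilon> / 2}"
  let ?C = "\<lambda>n. {w \<in> space Q. \<bar>W n w - (a * Y' w + Z' w)\<bar> > \<epsilon>}"
  have le: "measure Q (?C n) \<le> measure Q (?A n) + measure Q (?B n)" for n
  proof -
    have "measure Q (?C n) \<le> measure Q (?A n \<union> ?B n)"
    proof (rule finite_measure_mono_AE)
      show "AE w in Q. w \<in> ?C n \<longrightarrow> w \<in> ?A n \<union> ?B n"
        using W[of n]
      proof eventually_elim
        case (elim w)
        show ?case
        proof (rule ccontr)
          assume "\<not> (w \<in> ?C n \<longrightarrow> w \<in> ?A n \<union> ?B n)"
          then have w: "w \<in> ?C n" "\<bar>Y n w - Y' w\<bar> \<le> d" "\<bar>Z n w - Z' w\<bar> \<le> \<epsilon> / 2" by auto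
          have "\<bar>a * (Y n w - Y' w)\<bar> \<le> (\<bar>a\<bar> + 1) * d"
            unfolding abs_mult using w d by (intro mult_mono) auto
          moreover have "W n w - (a * Y' w + Z' w) = a * (Y n w - Y' w) + (Z n w - Z' w)"
            by (simp add: elim algebra_simps)
          ultimately have "\<bar>W n w - (a * Y' w + Z' w)\<bar> \<le> \<epsilon>" using w d by linarith
          then show False using w(1) by simp
        qed
      qed
    qed measurable
    also have "\<dots> \<le> measure Q (?A n) + measure Q (?B n)" by (rule measure_Un_le) measurable
    finally show ?thesis .
  qed
  have "(\<lambda>n. measure Q (?A n) + measure Q (?B n)) \<longlonglongrightarrow> 0 + 0"
    using Y[unfolded converges_in_probability_def, rule_format, OF d(1)]
      Z[unfolded converges_in_probability_def, rule_format, of "\<epsilon> / 2"] \<open>0 < \<epsilon>\<close>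
    by (intro tendsto_add) simp_all
  then have lim: "(\<lambda>n. measure Q (?A n) + measure Q (?B n)) \<longlonglongrightarrow> 0" by simp
  show "(\<lambda>n. measure Q (?C n)) \<longlonglongrightarrow> 0"
  proof (rule Lim_null_comparison[OF _ lim])
    show "eventually (\<lambda>n. norm (measure Q (?C n)) \<le> measure Q (?A n) + measure Q (?B n)) sequentially"
      unfolding real_norm_def abs_of_nonneg[OF measure_nonneg] using le by (rule always_eventually[OF allI])
  qed
qed

text \<open>The function exp (i \<theta> y) is Lipschitz in y with constant |\<theta>|, which
  handles close values, and two of its values differ by at most 2, which handles the event of small
  probability.\<close>

lemma converges_in_probability_imp_char:
  assumes Q: "prob_space Q"
    and [measurable]: "\<And>n. Y n \<in> borel_measurable Q" "Y' \<in> borel_measurable Q"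
    and Y: "converges_in_probability Q Y Y'"
  shows "(\<lambda>n. \<integral>w. iexp (\<theta> * Y n w) \<partial>Q) \<longlonglongrightarrow> (\<integral>w. iexp (\<theta> * Y' w) \<partial>Q)"
proof (rule LIMSEQ_I)
  fix r :: real assume r: "0 < r"
  interpret prob_space Q by (rule Q)
  \<comment> \<open>Close values then cost at most r/2; the exceptional event, of probability below
    r/4, costs less than the other r/2.\<close>
  define d where "d = r / (2 * (\<bar>\<theta>\<bar> + 1))"
  have d: "0 < d" "(\<bar>\<theta>\<bar> + 1) * d = r / 2" using r by (auto simp: d_def field_simps)
  let ?A = "\<lambda>n. {w \<in> space Q. \<bar>Y n w - Y' w\<bar> > d}"
  have int: "integrable Q (\<lambda>w. iexp (\<theta> * X w))" if [measurable]: "X \<in> borel_measurable Q" for X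
    by (intro integrable_iexp) measurable
  have bd: "norm (iexp (\<theta> * Y n w) - iexp (\<theta> * Y' w)) \<le> r / 2 + 2 * indicator (?A n) w"
    if "w \<in> space Q" for n w
  proof (cases "w \<in> ?A n")
    case True
    have "norm (iexp (\<theta> * Y n w) - iexp (\<theta> * Y' w)) \<le> norm (iexp (\<theta> * Y n w)) + norm (iexp (\<theta> * Y' w))"
      by (rule norm_triangle_ineq4)
    then show ?thesis using True r by simp
  next
    case False
    have "iexp (\<theta> * Y n w) - iexp (\<theta> * Y' w) = iexp (\<theta> * Y' w) * (iexp (\<theta> * (Y n w - Y' w)) - 1)"
      by (simp add: algebra_simps exp_diff)
    then have "norm (iexp (\<theta> * Y n w) - iexp (\<theta> * Y' w)) = norm (iexp (\<theta> * (Y n w - Y' w)) - 1)"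
      by (simp only: norm_mult norm_exp_i_times mult_1_left)
    also have "\<dots> \<le> \<bar>\<theta> * (Y n w - Y' w)\<bar>"
      using iexp_approx1[of "\<theta> * (Y n w - Y' w)" 0] by simp
    also have "\<dots> \<le> (\<bar>\<theta>\<bar> + 1) * d"
      unfolding abs_mult using False that d by (intro mult_mono) auto
    finally show ?thesis using d False by simp
  qed
  have "norm ((\<integral>w. iexp (\<theta> * Y n w) \<partial>Q) - (\<integral>w. iexp (\<theta> * Y' w) \<partial>Q)) \<le> r / 2 + 2 * measure Q (?A n)" for n
  proof -
    have "(\<integral>w. iexp (\<theta> * Y n w) \<partial>Q) - (\<integral>w. iexp (\<theta> * Y' w) \<partial>Q) =
        (\<integral>w. iexp (\<theta> * Y n w) - iexp (\<theta> * Y' w) \<partial>Q)"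
      by (intro Bochner_Integration.integral_diff[symmetric] int) measurable
    also have "norm \<dots> \<le> (\<integral>w. norm (iexp (\<theta> * Y n w) - iexp (\<theta> * Y' w)) \<partial>Q)"
      by (rule integral_norm_bound)
    also have "\<dots> \<le> (\<integral>w. r / 2 + 2 * indicator (?A n) w \<partial>Q)"
    proof (rule integral_mono)
      show "integrable Q (\<lambda>w. norm (iexp (\<theta> * Y n w) - iexp (\<theta> * Y' w)))"
        by (intro integrable_norm Bochner_Integration.integrable_diff int) measurable
      show "integrable Q (\<lambda>w. r / 2 + 2 * indicator (?A n) w :: real)"
        by (intro integrable_const_bound[of _ "r / 2 + 2"]) (use r in \<open>auto simp: indicator_def\<close>)
    qed (rule bd)
    also have "\<dots> = r / 2 + 2 * measure Q (?A n)"
    proof -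
      have "integrable Q (indicator (?A n) :: _ \<Rightarrow> real)"
        by (intro integrable_const_bound[of _ 1]) (auto simp: indicator_def)
      then show ?thesis by (simp add: prob_space)
    qed
    finally show ?thesis .
  qed
  note le = this
  have "eventually (\<lambda>n. measure Q (?A n) < r / 4) sequentially"
    using Y[unfolded converges_in_probability_def, rule_format, OF d(1)] r
    by (intro order_tendstoD(2)[of _ 0]) auto
  then have "eventually (\<lambda>n. norm ((\<integral>w. iexp (\<theta> * Y n w) \<partial>Q) - (\<integral>w. iexp (\<theta> * Y' w) \<partial>Q)) < r) sequentially"
  proof eventually_elim
    case (elim n)
    then show ?case using le[of n] by linarith
  qed
  then show "\<exists>N. \<forall>n\<ge>N. norm ((\<integral>w. iexp (\<theta> * Y n w) \<partial>Q) - (\<integral>w. iexp (\<theta> * Y' w) \<partial>Q)) < r"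
    by (simp add: eventually_sequentially)
qed

section \<open>Almost sure finite additivity of the random measure\<close>

lemma stable_random_measureD:
  assumes "stable_random_measure \<alpha> m Q M"
  shows "prob_space Q"
    and "A \<in> finite_measure_sets m \<Longrightarrow> M A \<in> borel_measurable Q"
    and "A \<in> finite_measure_sets m \<Longrightarrow>
      char (distr Q borel (M A)) \<theta> = exp (- (measure m A * \<bar>\<theta>\<bar> powr \<alpha>))"
    and "range B \<subseteq> finite_measure_sets m \<Longrightarrow> disjoint_family B \<Longrightarrow>
      prob_space.indep_vars Q (\<lambda>_. borel) (\<lambda>i. M (B i)) UNIV"
    and "range B \<subseteq> finite_measure_sets m \<Longrightarrow> disjoint_family B \<Longrightarrow>
      (\<Union>i. B i) \<in> finite_measure_sets m \<Longrightarrow> AE w in Q. (\<lambda>i. M (B i) w) sums M (\<Union>i. B i) w"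
  using assms unfolding stable_random_measure_def by blast+

lemma finite_measure_sets_empty: "{} \<in> finite_measure_sets m"
  by (simp add: finite_measure_sets_def)

lemma finite_measure_sets_Un:
  assumes "A \<in> finite_measure_sets m" "B \<in> finite_measure_sets m"
  shows "A \<union> B \<in> finite_measure_sets m"
proof -
  have "emeasure m (A \<union> B) \<le> emeasure m A + emeasure m B"
    using assms by (intro emeasure_subadditive) (auto simp: finite_measure_sets_def)
  also have "\<dots> < \<infinity>" using assms by (auto simp: finite_measure_sets_def)
  finally show ?thesis using assms by (auto simp: finite_measure_sets_def)
qed

lemma finite_measure_sets_UN:
  assumes "finite I" "\<And>i. i \<in> I \<Longrightarrow> A i \<in> finite_measure_sets m"
  shows "(\<Union>i\<in>I. A i) \<in> finite_measure_sets m"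
  using assms by (induction I) (auto intro: finite_measure_sets_empty finite_measure_sets_Un)

lemma finite_measure_sets_subset:
  assumes "B \<in> finite_measure_sets m" "A \<in> sets m" "A \<subseteq> B"
  shows "A \<in> finite_measure_sets m"
  using assms emeasure_mono[of A B m] by (auto simp: finite_measure_sets_def intro: le_less_trans)

text \<open>Countable additivity for the sequence of empty sets makes a constant series converge, so
  its term vanishes.\<close>

lemma stable_random_measure_empty:
  assumes M: "stable_random_measure \<alpha> m Q M"
  shows "AE w in Q. M {} w = 0"
proof -
  have "AE w in Q. (\<lambda>i::nat. M {} w) sums M (\<Union>i::nat. {}) w"
    by (rule stable_random_measureD(5)[OF M]) (auto simp: finite_measure_sets_empty disjoint_family_on_def)
  then show ?thesis
  proof eventually_elim
    case (elim w)
    then have "(\<lambda>i::nat. M {} w) \<longlonglongrightarrow> 0" by (intro summable_LIMSEQ_zero) (rule sums_summable)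
    then show ?case by (simp add: LIMSEQ_const_iff)
  qed
qed

text \<open>Countable additivity with the two sets padded by empty sets, whose values vanish almost
  surely.\<close>

lemma stable_random_measure_Un:
  assumes M: "stable_random_measure \<alpha> m Q M"
    and AB: "A \<in> finite_measure_sets m" "B \<in> finite_measure_sets m" "A \<inter> B = {}"
  shows "AE w in Q. M (A \<union> B) w = M A w + M B w"
proof -
  define C where "C i = (if i = 0 then A else if i = 1 then B else {})" for i :: nat
  have UN: "(\<Union>i. C i) = A \<union> B" by (auto simp: C_def split: if_splits)
  have "AE w in Q. (\<lambda>i. M (C i) w) sums M (\<Union>i. C i) w"
  proof (rule stable_random_measureD(5)[OF M])
    show "range C \<subseteq> finite_measure_sets m" using AB by (auto simp: C_def finite_measure_sets_empty)
    show "disjoint_family C" using AB by (auto simp: disjoint_family_on_def C_def)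
    show "(\<Union>i. C i) \<in> finite_measure_sets m" unfolding UN by (rule finite_measure_sets_Un[OF AB(1,2)])
  qed
  then show ?thesis using stable_random_measure_empty[OF M]
  proof eventually_elim
    case (elim w)
    have "(\<lambda>i. M (C i) w) sums (\<Sum>i\<in>{0,1}. M (C i) w)"
      by (rule sums_finite) (auto simp: C_def elim(2))
    then have "M (A \<union> B) w = (\<Sum>i\<in>{0,1}. M (C i) w)"
      using elim(1) unfolding UN by (blast intro: sums_unique2)
    then show ?case by (simp add: C_def)
  qed
qed

lemma stable_random_measure_UN:
  assumes M: "stable_random_measure \<alpha> m Q M"
    and "finite I" "\<And>i. i \<in> I \<Longrightarrow> A i \<in> finite_measure_sets m" "disjoint_family_on A I"
  shows "AE w in Q. M (\<Union>i\<in>I. A i) w = (\<Sum>i\<in>I. M (A i) w)"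
  using assms(2-)
proof (induction I)
  case empty
  then show ?case using stable_random_measure_empty[OF M] by simp
next
  case (insert i I)
  have "AE w in Q. M (\<Union>i\<in>I. A i) w = (\<Sum>i\<in>I. M (A i) w)"
    using insert.prems by (intro insert.IH) (auto simp: disjoint_family_on_def)
  moreover have "AE w in Q. M (A i \<union> (\<Union>i\<in>I. A i)) w = M (A i) w + M (\<Union>i\<in>I. A i) w"
  proof (rule stable_random_measure_Un[OF M])
    show "(\<Union>i\<in>I. A i) \<in> finite_measure_sets m"
      using insert by (intro finite_measure_sets_UN) auto
    show "A i \<inter> (\<Union>i\<in>I. A i) = {}"
      using insert.prems(2) insert.hyps(2) by (fastforce simp: disjoint_family_on_def)
  qed (use insert.prems in auto)
  ultimately show ?case
    by eventually_elim (simp add: insert.hyps)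
qed

section \<open>Integrals of simple functions\<close>

text \<open>The integral is defined through the level sets of the integrand, and different
  integrands have different level sets. This rewrites it over the cells of any finer partition,
  given by \<open>h\<close>. Cells of infinite measure are allowed where \<open>u\<close>
  vanishes.\<close>

lemma simple_stable_integral_comp:
  fixes h :: "'e \<Rightarrow> 'k" and u :: "'k \<Rightarrow> real"
  assumes M: "stable_random_measure \<alpha> m Q M" and h: "simple_function m h"
    and fin: "\<And>k. k \<in> h ` space m \<Longrightarrow> u k \<noteq> 0 \<Longrightarrow> h -` {k} \<inter> space m \<in> finite_measure_sets m"
  shows "AE w in Q. simple_stable_integral m M (\<lambda>x. u (h x)) w =
    (\<Sum>k\<in>h ` space m. u k * M (h -` {k} \<inter> space m) w)"
proof -
  let ?K = "h ` space m"
  have K: "finite ?K" using h by (simp add: simple_function_def)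
  have "AE w in Q. \<forall>c\<in>u ` ?K - {0}. M ((\<lambda>x. u (h x)) -` {c} \<inter> space m) w =
      (\<Sum>k\<in>{k\<in>?K. u k = c}. M (h -` {k} \<inter> space m) w)"
  proof (rule AE_finite_allI)
    show "finite (u ` ?K - {0})" using K by simp
    fix c assume c: "c \<in> u ` ?K - {0}"
    have eq: "(\<lambda>x. u (h x)) -` {c} \<inter> space m = (\<Union>k\<in>{k\<in>?K. u k = c}. h -` {k} \<inter> space m)" by auto
    show "AE w in Q. M ((\<lambda>x. u (h x)) -` {c} \<inter> space m) w =
      (\<Sum>k\<in>{k\<in>?K. u k = c}. M (h -` {k} \<inter> space m) w)"
      unfolding eq
      by (rule stable_random_measure_UN[OF M]) (use K c fin in \<open>auto simp: disjoint_family_on_def\<close>)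
  qed
  then show ?thesis
  proof eventually_elim
    case (elim w)
    have img: "(\<lambda>x. u (h x)) ` space m = u ` ?K" by auto
    have "(\<Sum>k\<in>?K. u k * M (h -` {k} \<inter> space m) w) =
        (\<Sum>c\<in>u ` ?K. \<Sum>k\<in>{k\<in>?K. u k = c}. u k * M (h -` {k} \<inter> space m) w)"
      by (rule sum.image_gen[OF K])
    also have "\<dots> = (\<Sum>c\<in>u ` ?K. c * (\<Sum>k\<in>{k\<in>?K. u k = c}. M (h -` {k} \<inter> space m) w))"
      by (rule sum.cong) (auto simp: sum_distrib_left)
    also have "\<dots> = (\<Sum>c\<in>u ` ?K - {0}. c * (\<Sum>k\<in>{k\<in>?K. u k = c}. M (h -` {k} \<inter> space m) w))"
      by (rule sum.mono_neutral_right) (use K in auto)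
    also have "\<dots> = (\<Sum>c\<in>u ` ?K - {0}. c * M ((\<lambda>x. u (h x)) -` {c} \<inter> space m) w)"
      by (rule sum.cong) (use elim in auto)
    finally show ?case by (simp add: simple_stable_integral_def img)
  qed
qed

lemma simple_L_alphaD:
  assumes g: "g \<in> simple_L_alpha m" and "c \<noteq> 0"
  shows "g -` {c} \<inter> space m \<in> finite_measure_sets m"
proof (rule finite_measure_sets_subset)
  have [measurable]: "g \<in> borel_measurable m"
    using g by (auto simp: simple_L_alpha_def intro: borel_measurable_simple_function)
  show "{x \<in> space m. g x \<noteq> 0} \<in> finite_measure_sets m"
    using g by (auto simp: simple_L_alpha_def finite_measure_sets_def)
  show "g -` {c} \<inter> space m \<in> sets m" by measurable
qed (use \<open>c \<noteq> 0\<close> in auto)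

lemma simple_stable_integral_measurable:
  assumes M: "stable_random_measure \<alpha> m Q M" and g: "g \<in> simple_L_alpha m"
  shows "simple_stable_integral m M g \<in> borel_measurable Q"
  unfolding simple_stable_integral_def[abs_def]
  by (intro borel_measurable_sum borel_measurable_times borel_measurable_const
      stable_random_measureD(2)[OF M] simple_L_alphaD[OF g]) auto

lemma simple_stable_integral_scale_add:
  assumes M: "stable_random_measure \<alpha> m Q M" and g: "g \<in> simple_L_alpha m" and h: "h \<in> simple_L_alpha m"
  shows "(\<lambda>x. a * g x + h x) \<in> simple_L_alpha m"
    and "AE w in Q. simple_stable_integral m M (\<lambda>x. a * g x + h x) w =
      a * simple_stable_integral m M g w + simple_stable_integral m M h w"
proof -
  have sf: "simple_function m g" "simple_function m h"
    using g h by (auto simp: simple_L_alpha_def)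
  have [measurable]: "g \<in> borel_measurable m" "h \<in> borel_measurable m"
    using sf by (auto intro: borel_measurable_simple_function)
  let ?S = "\<lambda>g. {x \<in> space m. g x \<noteq> (0::real)}"
  have S: "?S g \<in> finite_measure_sets m" "?S h \<in> finite_measure_sets m"
    using g h by (auto simp: simple_L_alpha_def finite_measure_sets_def)
  have "?S (\<lambda>x. a * g x + h x) \<in> finite_measure_sets m"
    by (rule finite_measure_sets_subset[OF finite_measure_sets_Un[OF S]]) auto
  then show "(\<lambda>x. a * g x + h x) \<in> simple_L_alpha m"
    using simple_function_compose2[OF sf, of "\<lambda>x y. a * x + y"]
    by (simp add: simple_L_alpha_def finite_measure_sets_def)
  \<comment> \<open>The pair yields a common refinement of the level sets of \<open>g\<close>,
    \<open>h\<close> and their combination.\<close>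
  define p where "p x = (g x, h x)" for x
  have p: "simple_function m p" unfolding p_def[abs_def] by (rule simple_function_Pair[OF sf])
  have cell: "p -` {k} \<inter> space m \<in> finite_measure_sets m" if "fst k \<noteq> 0 \<or> snd k \<noteq> 0" for k
    by (rule finite_measure_sets_subset[OF finite_measure_sets_Un[OF S]])
       (use that simple_functionD(2)[OF p] in \<open>auto simp: p_def\<close>)
  \<comment> \<open>The cell of (0, 0) may have infinite measure; its coefficient must therefore be
    0.\<close>
  have rep: "AE w in Q. simple_stable_integral m M (\<lambda>x. u (p x)) w =
      (\<Sum>k\<in>p ` space m. u k * M (p -` {k} \<inter> space m) w)" if "u (0, 0) = 0" for u
    by (rule simple_stable_integral_comp[OF M p], rule cell) (use that in \<open>metis prod.collapse\<close>)
  have "AE w in Q. simple_stable_integral m M (\<lambda>x. fst (p x)) w = (\<Sum>k\<in>p ` space m. fst k * M (p -` {k} \<inter> space m) w)"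
    "AE w in Q. simple_stable_integral m M (\<lambda>x. snd (p x)) w = (\<Sum>k\<in>p ` space m. snd k * M (p -` {k} \<inter> space m) w)"
    "AE w in Q. simple_stable_integral m M (\<lambda>x. a * fst (p x) + snd (p x)) w =
      (\<Sum>k\<in>p ` space m. (a * fst k + snd k) * M (p -` {k} \<inter> space m) w)"
    using rep[of fst] rep[of snd] rep[of "\<lambda>k. a * fst k + snd k"] by auto
  then show "AE w in Q. simple_stable_integral m M (\<lambda>x. a * g x + h x) w =
      a * simple_stable_integral m M g w + simple_stable_integral m M h w"
  proof eventually_elim
    case (elim w)
    then show ?case
      by (simp add: p_def distrib_right sum.distrib sum_distrib_left mult.assoc)
  qed
qed

lemma simple_L_alpha_subset:
  assumes "g \<in> simple_L_alpha m" "0 < \<alpha>"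
  shows "g \<in> L_alpha \<alpha> m"
    and "(\<integral>x. \<bar>g x\<bar> powr \<alpha> \<partial>m) = (\<Sum>c\<in>g ` space m - {0}. \<bar>c\<bar> powr \<alpha> * measure m (g -` {c} \<inter> space m))"
proof -
  let ?C = "g ` space m - {0}"
  have C: "finite ?C" and meas: "g \<in> borel_measurable m"
    using assms by (auto simp: simple_L_alpha_def simple_function_def intro: borel_measurable_simple_function)
  have A: "g -` {c} \<inter> space m \<in> sets m" "emeasure m (g -` {c} \<inter> space m) < \<infinity>" if "c \<in> ?C" for c
    using simple_L_alphaD[OF assms(1), of c] that by (auto simp: finite_measure_sets_def)
  have eq: "\<bar>g x\<bar> powr \<alpha> = (\<Sum>c\<in>?C. \<bar>c\<bar> powr \<alpha> * indicator (g -` {c} \<inter> space m) x)"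
    if x: "x \<in> space m" for x
  proof -
    have "(\<Sum>c\<in>?C. \<bar>c\<bar> powr \<alpha> * indicator (g -` {c} \<inter> space m) x) =
        (\<Sum>c\<in>?C. if c = g x then \<bar>c\<bar> powr \<alpha> else 0)"
      by (rule sum.cong) (use x in \<open>auto simp: indicator_def\<close>)
    also have "\<dots> = \<bar>g x\<bar> powr \<alpha>"
      using x C assms(2) by (simp add: sum.delta)
    finally show ?thesis by simp
  qed
  have int: "integrable m (\<lambda>x. \<Sum>c\<in>?C. \<bar>c\<bar> powr \<alpha> * indicator (g -` {c} \<inter> space m) x)"
    by (intro Bochner_Integration.integrable_sum integrable_mult_right integrable_real_indicator A)
  have "integrable m (\<lambda>x. \<bar>g x\<bar> powr \<alpha>)"
    by (rule Bochner_Integration.integrable_cong[THEN iffD2, OF refl eq int])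
  then show "g \<in> L_alpha \<alpha> m" using meas by (simp add: L_alpha_def)
  have "(\<integral>x. \<bar>g x\<bar> powr \<alpha> \<partial>m) = (\<integral>x. (\<Sum>c\<in>?C. \<bar>c\<bar> powr \<alpha> * indicator (g -` {c} \<inter> space m) x) \<partial>m)"
    by (rule Bochner_Integration.integral_cong[OF refl eq])
  also have "\<dots> = (\<Sum>c\<in>?C. \<bar>c\<bar> powr \<alpha> * measure m (g -` {c} \<inter> space m))"
  proof (subst Bochner_Integration.integral_sum)
    show "integrable m (\<lambda>x. \<bar>c\<bar> powr \<alpha> * indicator (g -` {c} \<inter> space m) x :: real)" if "c \<in> ?C" for c
      by (intro integrable_mult_right integrable_real_indicator A that)
    show "(\<Sum>c\<in>?C. \<integral>x. \<bar>c\<bar> powr \<alpha> * indicator (g -` {c} \<inter> space m) x \<partial>m) =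
      (\<Sum>c\<in>?C. \<bar>c\<bar> powr \<alpha> * measure m (g -` {c} \<inter> space m))"
      by (simp add: Int_absorb2 Int_assoc)
  qed
  finally show "(\<integral>x. \<bar>g x\<bar> powr \<alpha> \<partial>m) = (\<Sum>c\<in>?C. \<bar>c\<bar> powr \<alpha> * measure m (g -` {c} \<inter> space m))" .
qed

lemma char_scale:
  assumes [measurable]: "X \<in> borel_measurable Q"
  shows "char (distr Q borel (\<lambda>w. c * X w)) \<theta> = char (distr Q borel X) (c * \<theta>)"
  unfolding char_def by (simp add: integral_distr mult_ac)

text \<open>Level sets are disjoint, so the summands are independent and the characteristic function
  factors; the exponents add up to the integral of |g|^\<alpha>.\<close>

lemma char_simple_stable_integral:
  assumes \<alpha>: "0 < \<alpha>" and M: "stable_random_measure \<alpha> m Q M" and g: "g \<in> simple_L_alpha m"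
  shows "char (distr Q borel (simple_stable_integral m M g)) \<theta> =
    exp (- (\<bar>\<theta>\<bar> powr \<alpha> * (\<integral>x. \<bar>g x\<bar> powr \<alpha> \<partial>m)))"
proof -
  interpret prob_space Q by (rule stable_random_measureD(1)[OF M])
  let ?C = "g ` space m - {0}"
  let ?A = "\<lambda>c. g -` {c} \<inter> space m"
  have C: "finite ?C" using g by (simp add: simple_L_alpha_def simple_function_def)
  obtain e :: "real \<Rightarrow> nat" where e: "inj_on e ?C"
    using finite_imp_inj_to_nat_seg[OF C] by blast
  define d where "d = inv_into ?C e"
  have d: "d (e c) = c" if "c \<in> ?C" for c using e that by (simp add: d_def)
  define B where "B i = (if i \<in> e ` ?C then ?A (d i) else {})" for i
  have B: "B (e c) = ?A c" if "c \<in> ?C" for c using that by (simp add: B_def d)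
  have Bfin: "B i \<in> finite_measure_sets m" for i
    using d by (auto simp: B_def finite_measure_sets_empty intro!: simple_L_alphaD[OF g])
  have dinj: "i = j" if "i \<in> e ` ?C" "j \<in> e ` ?C" "d i = d j" for i j using that d by force
  have "indep_vars (\<lambda>_. borel) (\<lambda>i. M (B i)) UNIV"
  proof (rule stable_random_measureD(4)[OF M])
    show "range B \<subseteq> finite_measure_sets m" using Bfin by auto
    have "B i \<inter> B j = {}" if "i \<noteq> j" for i j
    proof (cases "i \<in> e ` ?C \<and> j \<in> e ` ?C")
      case True
      then have "d i \<noteq> d j" using dinj that by metis
      then show ?thesis by (auto simp: B_def)
    next
      case False
      then show ?thesis by (simp only: B_def) auto
    qed
    then show "disjoint_family B" by (simp add: disjoint_family_on_def)
  qed
  then have indep: "indep_vars (\<lambda>_. borel) (\<lambda>i. M (B i)) (e ` ?C)"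
    by (rule indep_vars_subset) simp
  have indep': "indep_vars (\<lambda>_. borel) (\<lambda>i w. d i * M (B i) w) (e ` ?C)"
    by (rule indep_vars_compose2[OF indep]) measurable
  have eq: "simple_stable_integral m M g w = (\<Sum>i\<in>e ` ?C. d i * M (B i) w)" for w
    unfolding simple_stable_integral_def by (subst sum.reindex[OF e]) (auto intro!: sum.cong simp: d B)
  have "char (distr Q borel (simple_stable_integral m M g)) \<theta> =
      (\<Prod>i\<in>e ` ?C. char (distr Q borel (\<lambda>w. d i * M (B i) w)) \<theta>)"
    unfolding eq[abs_def] by (rule char_distr_sum[OF indep'])
  also have "\<dots> = (\<Prod>i\<in>e ` ?C. complex_of_real (exp (- (measure m (B i) * \<bar>d i * \<theta>\<bar> powr \<alpha>))))"
    by (intro prod.cong refl)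
       (simp add: char_scale stable_random_measureD(2,3)[OF M Bfin])
  also have "\<dots> = (\<Prod>c\<in>?C. complex_of_real (exp (- (\<bar>\<theta>\<bar> powr \<alpha> * (\<bar>c\<bar> powr \<alpha> * measure m (?A c))))))"
    by (subst prod.reindex[OF e]) (auto intro!: prod.cong simp: d B abs_mult powr_mult mult_ac)
  also have "\<dots> = exp (- (\<bar>\<theta>\<bar> powr \<alpha> * (\<integral>x. \<bar>g x\<bar> powr \<alpha> \<partial>m)))"
    unfolding simple_L_alpha_subset(2)[OF g \<alpha>] sum_distrib_left of_real_prod[symmetric]
    using C by (simp add: exp_sum[symmetric] sum_negf)
  finally show ?thesis by simp
qed

section \<open>Characteristic functions and linearity of general integrals\<close>

text \<open>Both sides of the formula for simple functions pass to the limit: the left by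
  convergence in probability, the right by convergence in L^\<alpha>.\<close>

lemma has_stable_integral_char:
  assumes \<alpha>: "0 < \<alpha>" and M: "stable_random_measure \<alpha> m Q M" and f: "has_stable_integral \<alpha> m Q M f Y"
  shows "(\<integral>w. iexp (\<theta> * Y w) \<partial>Q) = exp (- (\<bar>\<theta>\<bar> powr \<alpha> * (\<integral>x. \<bar>f x\<bar> powr \<alpha> \<partial>m)))"
proof -
  have Q: "prob_space Q" by (rule stable_random_measureD(1)[OF M])
  obtain g where fL: "f \<in> L_alpha \<alpha> m" and Y: "Y \<in> borel_measurable Q"
    and g: "\<And>n. g n \<in> simple_L_alpha m" "(\<lambda>n. \<integral>x. \<bar>g n x - f x\<bar> powr \<alpha> \<partial>m) \<longlonglongrightarrow> 0"
      "converges_in_probability Q (\<lambda>n. simple_stable_integral m M (g n)) Y"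
    using f unfolding has_stable_integral_def by blast
  note meas = simple_stable_integral_measurable[OF M g(1)]
  have "(\<lambda>n. \<integral>w. iexp (\<theta> * simple_stable_integral m M (g n) w) \<partial>Q) \<longlonglongrightarrow> (\<integral>w. iexp (\<theta> * Y w) \<partial>Q)"
    by (rule converges_in_probability_imp_char[OF Q meas Y g(3)])
  moreover have "(\<integral>w. iexp (\<theta> * simple_stable_integral m M (g n) w) \<partial>Q) =
      complex_of_real (exp (- (\<bar>\<theta>\<bar> powr \<alpha> * (\<integral>x. \<bar>g n x\<bar> powr \<alpha> \<partial>m))))" for n
    using char_simple_stable_integral[OF \<alpha> M g(1), of n \<theta>]
    unfolding char_def by (simp add: integral_distr meas)
  moreover have "(\<lambda>n. complex_of_real (exp (- (\<bar>\<theta>\<bar> powr \<alpha> * (\<integral>x. \<bar>g n x\<bar> powr \<alpha> \<partial>m)))))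
      \<longlonglongrightarrow> complex_of_real (exp (- (\<bar>\<theta>\<bar> powr \<alpha> * (\<integral>x. \<bar>f x\<bar> powr \<alpha> \<partial>m))))"
    by (intro tendsto_intros integral_abs_powr_tendsto[OF \<alpha> fL _ g(2)] simple_L_alpha_subset(1)[OF g(1) \<alpha>])
  ultimately show ?thesis using LIMSEQ_unique by auto
qed

lemma has_stable_integral_scale_add:
  assumes \<alpha>: "0 < \<alpha>" and M: "stable_random_measure \<alpha> m Q M"
    and f: "has_stable_integral \<alpha> m Q M f Y" and g: "has_stable_integral \<alpha> m Q M g Z"
  shows "has_stable_integral \<alpha> m Q M (\<lambda>x. a * f x + g x) (\<lambda>w. a * Y w + Z w)"
proof -
  have Q: "prob_space Q" by (rule stable_random_measureD(1)[OF M])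
  obtain fs where fL: "f \<in> L_alpha \<alpha> m" and Y: "Y \<in> borel_measurable Q"
    and fs: "\<And>n. fs n \<in> simple_L_alpha m" "(\<lambda>n. \<integral>x. \<bar>fs n x - f x\<bar> powr \<alpha> \<partial>m) \<longlonglongrightarrow> 0"
      "converges_in_probability Q (\<lambda>n. simple_stable_integral m M (fs n)) Y"
    using f unfolding has_stable_integral_def by blast
  obtain gs where gL: "g \<in> L_alpha \<alpha> m" and Z: "Z \<in> borel_measurable Q"
    and gs: "\<And>n. gs n \<in> simple_L_alpha m" "(\<lambda>n. \<integral>x. \<bar>gs n x - g x\<bar> powr \<alpha> \<partial>m) \<longlonglongrightarrow> 0"
      "converges_in_probability Q (\<lambda>n. simple_stable_integral m M (gs n)) Z"
    using g unfolding has_stable_integral_def by blast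
  note lin = simple_stable_integral_scale_add[OF M fs(1) gs(1), where a = a]
  have "(\<lambda>n. \<integral>x. \<bar>(a * fs n x + gs n x) - (a * f x + g x)\<bar> powr \<alpha> \<partial>m) \<longlonglongrightarrow> 0"
  proof (rule Lim_null_comparison)
    let ?b = "\<lambda>n. 2 powr \<alpha> * \<bar>a\<bar> powr \<alpha> * (\<integral>x. \<bar>fs n x - f x\<bar> powr \<alpha> \<partial>m) +
        2 powr \<alpha> * (\<integral>x. \<bar>gs n x - g x\<bar> powr \<alpha> \<partial>m)"
    have "?b \<longlonglongrightarrow> 2 powr \<alpha> * \<bar>a\<bar> powr \<alpha> * 0 + 2 powr \<alpha> * 0" by (intro tendsto_intros fs(2) gs(2))
    then show "?b \<longlonglongrightarrow> 0" by simp
    have "norm (\<integral>x. \<bar>(a * fs n x + gs n x) - (a * f x + g x)\<bar> powr \<alpha> \<partial>m) \<le> ?b n" for n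
    proof -
      have "(\<integral>x. \<bar>a * (fs n x - f x) + (gs n x - g x)\<bar> powr \<alpha> \<partial>m) \<le> ?b n"
        by (intro L_alpha_scale_add(2) \<alpha> L_alpha_diff simple_L_alpha_subset(1) fs(1) gs(1) fL gL)
      moreover have "0 \<le> (\<integral>x. \<bar>a * (fs n x - f x) + (gs n x - g x)\<bar> powr \<alpha> \<partial>m)"
        by (rule integral_nonneg_AE) simp
      ultimately show ?thesis by (simp add: algebra_simps)
    qed
    then show "eventually (\<lambda>n. norm (\<integral>x. \<bar>(a * fs n x + gs n x) - (a * f x + g x)\<bar> powr \<alpha> \<partial>m) \<le> ?b n) sequentially"
      by (rule always_eventually[OF allI])
  qed
  moreover have "converges_in_probability Q
      (\<lambda>n. simple_stable_integral m M (\<lambda>x. a * fs n x + gs n x)) (\<lambda>w. a * Y w + Z w)"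
    by (rule converges_in_probability_scale_add[OF Q _ Y _ Z _ fs(3) gs(3) lin(2)])
       (intro simple_stable_integral_measurable[OF M] fs(1) gs(1) lin(1))+
  moreover have "(\<lambda>w. a * Y w + Z w) \<in> borel_measurable Q" using Y Z by measurable
  ultimately show ?thesis
    unfolding has_stable_integral_def using L_alpha_scale_add(1)[OF \<alpha> fL gL] lin(1)
    by (intro conjI exI[of _ "\<lambda>n x. a * fs n x + gs n x"]) auto
qed

lemma has_stable_integral_zero:
  assumes \<alpha>: "0 < \<alpha>"
  shows "has_stable_integral \<alpha> m Q M (\<lambda>_. 0) (\<lambda>_. 0)"
  unfolding has_stable_integral_def
proof (intro conjI exI[of _ "\<lambda>_ _. 0"])
  have "simple_stable_integral m M (\<lambda>_. 0) w = 0" for w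
    unfolding simple_stable_integral_def by (rule sum.neutral) auto
  then show "converges_in_probability Q (\<lambda>n. simple_stable_integral m M (\<lambda>_. 0)) (\<lambda>_. 0)"
    by (simp add: converges_in_probability_def)
qed (use \<alpha> in \<open>auto simp: L_alpha_def simple_L_alpha_def\<close>)

lemma has_stable_integral_sum:
  assumes \<alpha>: "0 < \<alpha>" and M: "stable_random_measure \<alpha> m Q M"
    and "finite J" and "\<And>j. j \<in> J \<Longrightarrow> has_stable_integral \<alpha> m Q M (f j) (Y j)"
  shows "has_stable_integral \<alpha> m Q M (\<lambda>x. \<Sum>j\<in>J. a j * f j x) (\<lambda>w. \<Sum>j\<in>J. a j * Y j w)"
  using assms(3,4)
proof (induction J)
  case empty
  then show ?case using has_stable_integral_zero[OF \<alpha>] by simp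
next
  case (insert j J)
  then have "has_stable_integral \<alpha> m Q M (\<lambda>x. a j * f j x + (\<Sum>j\<in>J. a j * f j x)) (\<lambda>w. a j * Y j w + (\<Sum>j\<in>J. a j * Y j w))"
    by (intro has_stable_integral_scale_add[OF \<alpha> M]) auto
  then show ?case using insert.hyps by simp
qed

text \<open>A linear combination of integrals is itself the integral of the combined kernel, so the
  one-dimensional formula at \<theta> = 1 gives the joint one.\<close>

lemma stable_integral_joint_char:
  assumes "0 < \<alpha>" "stable_random_measure \<alpha> m Q M"
    and "finite J" "\<And>j. j \<in> J \<Longrightarrow> has_stable_integral \<alpha> m Q M (f j) (Y j)"
  shows "(\<integral>w. iexp (\<Sum>j\<in>J. a j * Y j w) \<partial>Q) =
    complex_of_real (exp (- (\<integral>x. \<bar>\<Sum>j\<in>J. a j * f j x\<bar> powr \<alpha> \<partial>m)))"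
  using has_stable_integral_char[OF assms(1,2) has_stable_integral_sum[OF assms, where a = a], where \<theta> = 1] by simp

section \<open>Composition of independent copies\<close>

text \<open>Let E denote the expectation. Since 0 \<le> n (1 - exp (-K/n)) \<le> K, dominated
  convergence gives n (1 - E exp (-K/n)) \<longlonglongrightarrow> E K, with only a first moment.
  The powers are then compared with (1 - E K / n)^n by |a^n - b^n| \<le> n |a - b| for a, b in the
  unit disc.\<close>

lemma power_expectation_exp_tendsto:
  fixes K :: "'w \<Rightarrow> real"
  assumes M: "prob_space M" and K: "integrable M K" and nonneg: "\<And>w. 0 \<le> K w"
  shows "(\<lambda>n. (\<integral>w. exp (- (K w / real n)) \<partial>M) ^ n) \<longlonglongrightarrow> exp (- (\<integral>w. K w \<partial>M))"
proof -
  interpret prob_space M by (rule M)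
  have [measurable]: "K \<in> borel_measurable M" using K by simp
  define E where "E n = (\<integral>w. exp (- (K w / real n)) \<partial>M)" for n
  define k where "k = (\<integral>w. K w \<partial>M)"
  have int: "integrable M (\<lambda>w. exp (- (K w / real n)))" for n
    by (intro integrable_const_bound[of _ 1]) (auto simp: nonneg)
  have E01: "0 \<le> E n" "E n \<le> 1" for n
  proof -
    show "0 \<le> E n" unfolding E_def by (intro integral_nonneg_AE) simp
    have "E n \<le> (\<integral>w. 1 \<partial>M)" unfolding E_def
      by (rule integral_mono[OF int]) (auto simp: nonneg)
    then show "E n \<le> 1" by (simp add: prob_space)
  qed
  have le: "real n * (1 - exp (- (x / real n))) \<le> x" if "0 \<le> x" for x n
  proof (cases "n = 0")
    case False
    have "1 - exp (- (x / real n)) \<le> x / real n" using exp_ge_add_one_self[of "- (x / real n)"] by linarith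
    then show ?thesis using False by (simp add: field_simps)
  qed (simp add: that)
  have lim: "(\<lambda>n. real n * (1 - exp (- (x / real n)))) \<longlonglongrightarrow> x" if x: "0 \<le> x" for x
  \<comment> \<open>With z = x/n the bounds are z / (1 + z) \<le> 1 - exp (-z) \<le> z, multiplied
    by n.\<close>
  proof (rule tendsto_sandwich[OF _ always_eventually _ tendsto_const])
    have "(\<lambda>n. x / (1 + x / real n)) \<longlonglongrightarrow> x / (1 + 0)"
      by (intro tendsto_intros lim_const_over_n) auto
    then show "(\<lambda>n. x / (1 + x / real n)) \<longlonglongrightarrow> x" by simp
    show "\<forall>n. real n * (1 - exp (- (x / real n))) \<le> x" using le[OF x] by blast
    show "eventually (\<lambda>n. x / (1 + x / real n) \<le> real n * (1 - exp (- (x / real n)))) sequentially"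
      using eventually_gt_at_top[of 0]
    proof eventually_elim
      case (elim n)
      define z where "z = x / real n"
      have z: "0 \<le> z" using x by (simp add: z_def)
      have "exp (- z) \<le> 1 / (1 + z)"
        using z exp_ge_add_one_self[of z] unfolding exp_minus inverse_eq_divide
        by (intro divide_left_mono) auto
      then have "z / (1 + z) \<le> 1 - exp (- z)" using z by (simp add: field_simps)
      then have "real n * (z / (1 + z)) \<le> real n * (1 - exp (- z))" by (intro mult_left_mono) auto
      moreover have "x / (1 + x / real n) = real n * (z / (1 + z))" unfolding z_def using elim by simp
      ultimately show ?case by (simp only: z_def)
    qed
  qed
  have a: "(\<lambda>n. real n * (1 - E n)) \<longlonglongrightarrow> k"
  proof -
    have lim': "(\<lambda>n. \<integral>w. real n * (1 - exp (- (K w / real n))) \<partial>M) \<longlonglongrightarrow> (\<integral>w. K w \<partial>M)"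
    proof (rule integral_dominated_convergence[OF _ _ K])
      show "AE w in M. (\<lambda>n. real n * (1 - exp (- (K w / real n)))) \<longlonglongrightarrow> K w" using lim nonneg by blast
      show "AE w in M. norm (real n * (1 - exp (- (K w / real n)))) \<le> K w" for n
      proof (rule AE_I2)
        fix w
        have "0 \<le> real n * (1 - exp (- (K w / real n)))" by (intro mult_nonneg_nonneg) (auto simp: nonneg)
        then show "norm (real n * (1 - exp (- (K w / real n)))) \<le> K w" using le[OF nonneg, of n w] by simp
      qed
    qed measurable
    have eq: "(\<integral>w. real n * (1 - exp (- (K w / real n))) \<partial>M) = real n * (1 - E n)" for n
    proof -
      have "(\<integral>w. real n * (1 - exp (- (K w / real n))) \<partial>M) = real n * (\<integral>w. 1 - exp (- (K w / real n)) \<partial>M)"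
        by (rule integral_mult_right_zero)
      also have "(\<integral>w. 1 - exp (- (K w / real n)) \<partial>M) = 1 - E n"
        using int[of n] by (subst Bochner_Integration.integral_diff) (simp_all add: E_def prob_space)
      finally show ?thesis .
    qed
    show ?thesis using lim' unfolding eq k_def .
  qed
  have "(\<lambda>n. E n ^ n - (1 + (- k) / real n) ^ n) \<longlonglongrightarrow> 0"
  proof (rule Lim_null_comparison)
    have "(\<lambda>n. \<bar>real n * (1 - E n) - k\<bar>) \<longlonglongrightarrow> \<bar>k - k\<bar>" by (intro tendsto_intros a)
    then show "(\<lambda>n. \<bar>real n * (1 - E n) - k\<bar>) \<longlonglongrightarrow> 0" by simp
    obtain N where N: "k \<le> real N" using real_arch_simple by blast
    have k0: "0 \<le> k" unfolding k_def by (intro integral_nonneg_AE) (simp add: nonneg)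
    show "eventually (\<lambda>n. norm (E n ^ n - (1 + (- k) / real n) ^ n) \<le> \<bar>real n * (1 - E n) - k\<bar>) sequentially"
      \<comment> \<open>This ensures n > 0 and k \<le> n, hence |1 - k/n| \<le> 1.\<close>
      using eventually_ge_at_top[of "Suc N"]
    proof eventually_elim
      case (elim n)
      then have n: "0 < real n" "k \<le> real n" using N by auto
      then have b: "norm (1 + (- k) / real n) \<le> 1" using k0 by (simp add: abs_le_iff field_simps)
      have "norm (E n ^ n - (1 + (- k) / real n) ^ n) \<le> real n * norm (E n - (1 + (- k) / real n))"
        using E01[of n] by (intro norm_power_diff b) simp
      also have "\<dots> = \<bar>real n * (E n - (1 + (- k) / real n))\<bar>" using n by (simp add: abs_mult)
      also have "real n * (E n - (1 + (- k) / real n)) = - (real n * (1 - E n) - k)"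
        using n by (simp add: field_simps)
      finally show ?case by simp
    qed
  qed
  from tendsto_add[OF this tendsto_exp_limit_sequentially[of "- k"]]
  show ?thesis by (simp add: E_def k_def)
qed

section \<open>Freezing the random evaluation points\<close>

lemma subalgebra_ident_measurable:
  assumes "subalgebra R F"
  shows "(\<lambda>w. w) \<in> measurable R F"
  using assms by (auto simp: measurable_def subalgebra_def)

text \<open>Independence of two sub-sigma-algebras says that the diagonal map w -> (w, w) carries
  \<open>M\<close> to the product of its restrictions to them. Fubini then integrates over the first
  argument with the second frozen.\<close>

lemma (in prob_space) integral_indep_subalgebras:
  fixes g :: "'a \<Rightarrow> 'a \<Rightarrow> complex"
  assumes FG: "subalgebra M F" "subalgebra M G" and indep: "indep_set (sets F) (sets G)"
    and g: "(\<lambda>(x, y). g x y) \<in> borel_measurable (F \<Otimes>\<^sub>M G)" and bd: "\<And>x y. norm (g x y) \<le> C"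
  shows "(\<integral>w. g w w \<partial>M) = (\<integral>y. (\<integral>x. g x y \<partial>M) \<partial>M)"
proof -
  note id = subalgebra_ident_measurable[OF FG(1)] subalgebra_ident_measurable[OF FG(2)]
  have sp: "space F = space M" "space G = space M" using FG by (auto simp: subalgebra_def)
  \<comment> \<open>The identity map, taken as a random variable with values in \<open>N\<close>,
    generates \<open>N\<close> itself.\<close>
  have sig: "sigma_sets (space M) {(\<lambda>w. w) -` A \<inter> space M |A. A \<in> sets N} = sets N"
    if "subalgebra M N" for N
  proof -
    have spN: "space N = space M" using that by (simp add: subalgebra_def)
    have "{(\<lambda>w. w) -` A \<inter> space M |A. A \<in> sets N} = sets N"
      using sets.sets_into_space[of _ N] spN by (auto simp: Int_absorb2)
    then show ?thesis using sets.sigma_sets_eq[of N] spN by simp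
  qed
  have "indep_var F (\<lambda>w. w) G (\<lambda>w. w)"
    unfolding indep_var_eq sig[OF FG(1)] sig[OF FG(2)] using id indep by simp
  then have distr: "distr M F (\<lambda>w. w) \<Otimes>\<^sub>M distr M G (\<lambda>w. w) = distr M (F \<Otimes>\<^sub>M G) (\<lambda>w. (w, w))"
    unfolding indep_var_distribution_eq by simp
  interpret F: prob_space "distr M F (\<lambda>w. w)" by (rule prob_space_distr[OF id(1)])
  interpret G: prob_space "distr M G (\<lambda>w. w)" by (rule prob_space_distr[OF id(2)])
  interpret FG: pair_prob_space "distr M F (\<lambda>w. w)" "distr M G (\<lambda>w. w)" ..
  have g': "(\<lambda>(x, y). g x y) \<in> borel_measurable (distr M F (\<lambda>w. w) \<Otimes>\<^sub>M distr M G (\<lambda>w. w))"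
    using g by simp
  have int: "integrable (distr M F (\<lambda>w. w) \<Otimes>\<^sub>M distr M G (\<lambda>w. w)) (\<lambda>(x, y). g x y)"
    by (rule FG.P.integrable_const_bound[OF _ g', of C]) (use bd in auto)
  have "(\<integral>w. g w w \<partial>M) = (\<integral>z. (case z of (x, y) \<Rightarrow> g x y) \<partial>distr M (F \<Otimes>\<^sub>M G) (\<lambda>w. (w, w)))"
    by (subst integral_distr[OF measurable_Pair[OF id] g]) simp
  also have "\<dots> = (\<integral>y. (\<integral>x. g x y \<partial>distr M F (\<lambda>w. w)) \<partial>distr M G (\<lambda>w. w))"
    unfolding distr[symmetric] using FG.integral_snd[OF int] by simp
  also have "\<dots> = (\<integral>y. (\<integral>x. g x y \<partial>distr M F (\<lambda>w. w)) \<partial>M)"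
  proof (rule integral_distr[OF id(2)])
    have "(\<lambda>y. \<integral>x. g x y \<partial>distr M F (\<lambda>w. w)) \<in> borel_measurable (distr M G (\<lambda>w. w))"
      using int by (intro borel_measurable_integrable FG.integrable_snd)
    then show "(\<lambda>y. \<integral>x. g x y \<partial>distr M F (\<lambda>w. w)) \<in> borel_measurable G" by simp
  qed
  also have "\<dots> = (\<integral>y. (\<integral>x. g x y \<partial>M) \<partial>M)"
  proof (rule Bochner_Integration.integral_cong[OF refl])
    fix y assume "y \<in> space M"
    then have "y \<in> space G" by (simp add: sp)
    then have "(\<lambda>x. g x y) \<in> borel_measurable F" using measurable_Pair1[OF g] by simp
    then show "(\<integral>x. g x y \<partial>distr M F (\<lambda>w. w)) = (\<integral>x. g x y \<partial>M)"
      by (rule integral_distr[OF id(1)])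
  qed
  finally show ?thesis .
qed

lemma same_fdd_integral:
  fixes h :: "('s \<Rightarrow> 'a::topological_space) \<Rightarrow> 'b::{banach, second_countable_topology}"
  assumes "same_fdd P Z Q Y" "finite J"
    and "\<And>s. s \<in> J \<Longrightarrow> Z s \<in> borel_measurable P" "\<And>s. s \<in> J \<Longrightarrow> Y s \<in> borel_measurable Q"
    and h: "h \<in> borel_measurable (\<Pi>\<^sub>M s\<in>J. borel)"
  shows "(\<integral>w. h (\<lambda>s\<in>J. Z s w) \<partial>P) = (\<integral>w. h (\<lambda>s\<in>J. Y s w) \<partial>Q)"
proof -
  have "(\<integral>z. h z \<partial>fdd P Z J) = (\<integral>z. h z \<partial>fdd Q Y J)"
    using assms(1,2) by (simp add: same_fdd_def)
  then show ?thesis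
    unfolding fdd_def
    by (simp add: integral_distr[OF measurable_restrict h] assms(3,4))
qed

text \<open>The map \<open>U\<close> lets a field over one sigma-algebra be read on a finer one or
  on a product space.\<close>

lemma measurable_field_comp:
  assumes "measurable_field N Z" "T \<in> borel_measurable M" "U \<in> measurable M N"
  shows "(\<lambda>w. Z (T w) (U w)) \<in> borel_measurable M"
  using measurable_compose[OF measurable_Pair[OF assms(2,3)] assms(1)[unfolded measurable_field_def]]
  by simp

lemma measurable_field_marginal:
  assumes "measurable_field N Z"
  shows "Z s \<in> borel_measurable N"
  using measurable_field_comp[OF assms measurable_const measurable_ident, of s] by simp

lemma stable_representation_joint_char:
  assumes \<alpha>: "0 < \<alpha>" and M: "stable_random_measure \<alpha> m Q M" and rep: "stable_representation \<alpha> m Q M f P X"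
    and X: "\<And>s. X s \<in> borel_measurable P"
    and Z: "same_fdd R Z P X" "\<And>s. Z s \<in> borel_measurable R" and J: "finite J"
  shows "(\<integral>w. iexp (\<Sum>j\<in>J. a j * Z (y j) w) \<partial>R) =
    complex_of_real (exp (- (\<integral>x. \<bar>\<Sum>j\<in>J. a j * f (y j) x\<bar> powr \<alpha> \<partial>m)))"
proof -
  obtain I where I: "\<And>s. has_stable_integral \<alpha> m Q M (f s) (I s)" and XI: "same_fdd P X Q I"
    using rep unfolding stable_representation_def by blast
  have I_meas: "I s \<in> borel_measurable Q" for s using I unfolding has_stable_integral_def by blast
  have ZI: "same_fdd R Z Q I" using Z(1) XI by (simp add: same_fdd_def)
  \<comment> \<open>The points \<open>y j\<close> may coincide for different \<open>j\<close>, so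
    the finite-dimensional law is taken on the image of \<open>J\<close> under \<open>y\<close>, and
    repeated points simply share a coordinate.\<close>
  let ?h = "\<lambda>z. iexp (\<Sum>j\<in>J. a j * z (y j))"
  have [measurable]: "(\<lambda>z. z (y j)) \<in> borel_measurable (\<Pi>\<^sub>M s\<in>y ` J. borel)" if "j \<in> J" for j
    using that by (intro measurable_component_singleton) auto
  have h: "?h \<in> borel_measurable (\<Pi>\<^sub>M s\<in>y ` J. borel)" by measurable
  have eq: "(\<Sum>j\<in>J. a j * (\<lambda>s\<in>y ` J. z s) (y j)) = (\<Sum>j\<in>J. a j * z (y j))" for z by (rule sum.cong) auto
  have "(\<integral>w. iexp (\<Sum>j\<in>J. a j * Z (y j) w) \<partial>R) = (\<integral>w. iexp (\<Sum>j\<in>J. a j * I (y j) w) \<partial>Q)"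
    using same_fdd_integral[OF ZI finite_imageI[OF J, of y] Z(2) I_meas h] by (simp only: eq)
  also have "\<dots> = complex_of_real (exp (- (\<integral>x. \<bar>\<Sum>j\<in>J. a j * f (y j) x\<bar> powr \<alpha> \<partial>m)))"
    by (rule stable_integral_joint_char[OF \<alpha> M J I])
  finally show ?thesis .
qed

text \<open>Makes the scale a measurable function of finitely many points, so that its law depends
  only on the finite-dimensional law of these points.\<close>

lemma stable_scale_measurable:
  fixes f :: "'s::topological_space \<Rightarrow> 'e \<Rightarrow> real"
  assumes m: "sigma_finite_measure m" and f: "(\<lambda>(s, x). f s x) \<in> borel_measurable (borel \<Otimes>\<^sub>M m)"
    and J: "finite J"
  shows "(\<lambda>y. \<integral>x. \<bar>\<Sum>j\<in>J. a j * f (y j) x\<bar> powr \<alpha> \<partial>m) \<in> borel_measurable (\<Pi>\<^sub>M j\<in>J. borel)"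
proof -
  interpret sigma_finite_measure m by (rule m)
  have "(\<lambda>z. f (fst z j) (snd z)) \<in> borel_measurable ((\<Pi>\<^sub>M j\<in>J. borel) \<Otimes>\<^sub>M m)" if "j \<in> J" for j
  proof -
    have "(\<lambda>z. (fst z j, snd z)) \<in> measurable ((\<Pi>\<^sub>M j\<in>J. borel) \<Otimes>\<^sub>M m) (borel \<Otimes>\<^sub>M m)"
      using that by measurable
    from measurable_compose[OF this f] show ?thesis by simp
  qed
  note [measurable] = this
  have "(\<lambda>z. \<bar>\<Sum>j\<in>J. a j * f (fst z j) (snd z)\<bar> powr \<alpha>) \<in> borel_measurable ((\<Pi>\<^sub>M j\<in>J. borel) \<Otimes>\<^sub>M m)"
    by measurable
  then show ?thesis
    by (intro borel_measurable_lebesgue_integral) (simp add: case_prod_unfold)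
qed

lemma indep_sets_sum_pair:
  assumes "prob_space R" and indep: "prob_space.indep_sets R (case_sum (\<lambda>l. sets (F l)) (\<lambda>l. sets (G l))) UNIV"
  shows "prob_space.indep_set R (sets (F l)) (sets (G l))"
proof -
  interpret prob_space R by fact
  have sub: "case_sum (\<lambda>l. sets (F l)) (\<lambda>l. sets (G l)) i \<subseteq> events" for i
    using indep unfolding indep_sets_def by blast
  have "sets (F l) \<subseteq> events" "sets (G l) \<subseteq> events"
    using sub[of "Inl l"] sub[of "Inr l"] by simp_all
  moreover have "prob (a \<inter> b) = prob a * prob b" if "a \<in> sets (F l)" "b \<in> sets (G l)" for a b
    using indep_setsD[OF indep, of "{Inl l, Inr l}" "case_sum (\<lambda>_. a) (\<lambda>_. b)"] that by simp
  ultimately show ?thesis unfolding indep_sets2_eq by blast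
qed

text \<open>Joining \<open>F l\<close> and \<open>G l\<close> for each \<open>l\<close> preserves
  independence in \<open>l\<close>. The hypothesis on \<open>W\<close> ranges over all
  sigma-algebras containing both because it is used for the generated one and for
  \<open>R\<close>.\<close>

lemma indep_vars_sum_pair:
  fixes F G :: "nat \<Rightarrow> 'r measure" and W :: "nat \<Rightarrow> 'r \<Rightarrow> real"
  assumes "prob_space R" and indep: "prob_space.indep_sets R (case_sum (\<lambda>l. sets (F l)) (\<lambda>l. sets (G l))) UNIV"
    and FG: "\<And>l. subalgebra R (F l)" "\<And>l. subalgebra R (G l)"
    and W: "\<And>l N. subalgebra N (F l) \<Longrightarrow> subalgebra N (G l) \<Longrightarrow> W l \<in> borel_measurable N"
  shows "prob_space.indep_vars R (\<lambda>_. borel) W UNIV"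
proof -
  interpret prob_space R by fact
  let ?E = "case_sum (\<lambda>l. sets (F l)) (\<lambda>l. sets (G l))"
  have "indep_sets (\<lambda>l. sigma_sets (space R) (\<Union>i\<in>{Inl l, Inr l}. ?E i)) UNIV"
  proof (rule indep_sets_collect_sigma)
    show "indep_sets ?E (\<Union>l\<in>UNIV. {Inl l, Inr l})"
      by (rule indep_sets_mono_index[OF _ indep]) simp
    show "Int_stable (?E i)" for i by (cases i) (auto simp: sets.Int_stable)
    show "disjoint_family (\<lambda>l. {Inl l, Inr l})" by (auto simp: disjoint_family_on_def)
  qed
  then have "indep_sets (\<lambda>l. {W l -` A \<inter> space R |A. A \<in> sets borel}) UNIV"
  proof (rule indep_sets_mono_sets)
    fix l
    define N where "N = sigma (space R) (sets (F l) \<union> sets (G l))"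
    have sub: "sets (F l) \<union> sets (G l) \<subseteq> Pow (space R)"
      using FG[of l] sets.space_closed[of "F l"] sets.space_closed[of "G l"] by (auto simp: subalgebra_def)
    have N: "space N = space R" "sets N = sigma_sets (space R) (sets (F l) \<union> sets (G l))"
      unfolding N_def using sub by (simp_all add: space_measure_of sets_measure_of)
    have "W l \<in> borel_measurable N"
      by (rule W) (use FG[of l] in \<open>auto simp: subalgebra_def N intro: sigma_sets.Basic\<close>)
    then show "{W l -` A \<inter> space R |A. A \<in> sets borel} \<subseteq> sigma_sets (space R) (\<Union>i\<in>{Inl l, Inr l}. ?E i)"
      using measurable_sets[of "W l" N borel] by (auto simp: N)
  qed
  moreover have "random_variable borel (W l)" for l by (rule W[OF FG])
  ultimately show ?thesis unfolding indep_vars_def2 by blast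
qed

section \<open>The characteristic function of the normalized sum and its limit\<close>

theorem theorem2p2:
  fixes \<alpha> H H' :: real
    and P :: "'w measure" and X :: "real^'d \<Rightarrow> 'w \<Rightarrow> real"
    and m :: "'e measure" and f :: "real^'d \<Rightarrow> 'e \<Rightarrow> real"
    and Q0 :: "'q measure" and M0 :: "'e set \<Rightarrow> 'q \<Rightarrow> real"
    and P' :: "'p measure" and \<tau> :: "real^'n \<Rightarrow> 'p \<Rightarrow> real^'d"
    and Q :: "'v measure" and M :: "('e \<times> 'p) set \<Rightarrow> 'v \<Rightarrow> real"
    and X\<tau> :: "real^'n \<Rightarrow> 'v \<Rightarrow> real"
    and R :: "'r measure"
    and XX :: "nat \<Rightarrow> real^'d \<Rightarrow> 'r \<Rightarrow> real" and TT :: "nat \<Rightarrow> real^'n \<Rightarrow> 'r \<Rightarrow> real^'d"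
  assumes "0 < \<alpha>" and "\<alpha> < 2" and "0 < H" and "0 < H'"
    and "prob_space P" and "fractional_stable_field \<alpha> H P X"
    and "sigma_finite_measure m"
    and "(\<lambda>(s, x). f s x) \<in> borel_measurable (borel \<Otimes>\<^sub>M m)"
    and "stable_random_measure \<alpha> m Q0 M0" and "stable_representation \<alpha> m Q0 M0 f P X"
    and "prob_space P'" and "measurable_field P' \<tau>" and "sssis H' P' \<tau>"
    and "\<And>t. integrable P' (\<lambda>w'. norm (\<tau> t w') powr (H * \<alpha>))"
    and "stabilized_subordination \<alpha> m f P' \<tau> Q M X\<tau>"
    and "prob_space R" and "independent_copies R P X P' \<tau> XX TT"
  shows "fdd_converges R
           (\<lambda>n t w. real n powr (- 1 / \<alpha>) * (\<Sum>l<n. XX l (TT l t w) w)) Q X\<tau>"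
proof -
  have \<alpha>: "0 < \<alpha>" by fact
  interpret R: prob_space R by fact
  interpret P': prob_space P' by fact
  interpret m: sigma_finite_measure m by fact
  interpret mP': pair_sigma_finite m P' ..
  have M0: "stable_random_measure \<alpha> m Q0 M0" by fact
  have rep: "stable_representation \<alpha> m Q0 M0 f P X" by fact
  have f: "(\<lambda>(s, x). f s x) \<in> borel_measurable (borel \<Otimes>\<^sub>M m)" by fact
  have M: "stable_random_measure \<alpha> (m \<Otimes>\<^sub>M P') Q M"
    and X\<tau>: "\<And>t. has_stable_integral \<alpha> (m \<Otimes>\<^sub>M P') Q M (\<lambda>(x, w'). f (\<tau> t w') x) (X\<tau> t)"
    using assms(15) by (auto simp: stabilized_subordination_def)
  have X: "X s \<in> borel_measurable P" for s
    using assms(6) by (auto simp: fractional_stable_field_def intro: measurable_field_marginal)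
  have \<tau>: "\<tau> t \<in> borel_measurable P'" for t
    using assms(12) by (rule measurable_field_marginal)
  obtain F G where XX: "\<And>l. same_fdd R (XX l) P X" and TT: "\<And>l. same_fdd R (TT l) P' \<tau>"
    and F: "\<And>l. subalgebra R (F l)" and XXF: "\<And>l. measurable_field (F l) (XX l)"
    and G: "\<And>l. subalgebra R (G l)" and TTG: "\<And>l t. TT l t \<in> borel_measurable (G l)"
    and indep: "R.indep_sets (case_sum (\<lambda>l. sets (F l)) (\<lambda>l. sets (G l))) UNIV"
    using assms(17) unfolding independent_copies_def by blast
  have comp: "(\<lambda>w. XX l (TT l t w) w) \<in> borel_measurable N"
    if "subalgebra N (F l)" "subalgebra N (G l)" for l t and N :: "'r measure"
    by (rule measurable_field_comp[OF XXF measurable_compose[OF subalgebra_ident_measurable[OF that(2)] TTG]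
          subalgebra_ident_measurable[OF that(1)]])
  have XX_meas: "XX l s \<in> borel_measurable R" for l s
    using measurable_compose[OF subalgebra_ident_measurable[OF F] measurable_field_marginal[OF XXF]] by simp
  have TT_meas: "TT l t \<in> borel_measurable R" for l t
    using measurable_compose[OF subalgebra_ident_measurable[OF G] TTG] by simp
  show ?thesis
  proof (rule fdd_converges_of_char)
    show "prob_space R" by fact
    show "prob_space Q" by (rule stable_random_measureD(1)[OF M])
    show "(\<lambda>w. real n powr (- 1 / \<alpha>) * (\<Sum>l<n. XX l (TT l t w) w)) \<in> borel_measurable R" for n t
      by (intro borel_measurable_times borel_measurable_const borel_measurable_sum comp F G)
    show "X\<tau> t \<in> borel_measurable Q" for t using X\<tau> unfolding has_stable_integral_def by blast
    fix J :: "(real^'n) set" and a :: "real^'n \<Rightarrow> real"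
    assume J: "finite J"
    define W where "W l w = (\<Sum>j\<in>J. a j * XX l (TT l j w) w)" for l w
    \<comment> \<open>The conditional scale as a function of deterministic points. It is kept apart
      from \<tau> because it is evaluated first at a copy \<open>TT l\<close> and then transferred
      to \<tau>.\<close>
    define S where "S y = (\<integral>x. \<bar>\<Sum>j\<in>J. a j * f (y j) x\<bar> powr \<alpha> \<partial>m)" for y
    define K where "K w' = S (\<lambda>j. \<tau> j w')" for w'
    have W_indep: "R.indep_vars (\<lambda>_. borel) W UNIV"
      by (rule indep_vars_sum_pair[OF \<open>prob_space R\<close> indep F G])
         (unfold W_def[abs_def], intro borel_measurable_sum borel_measurable_times borel_measurable_const comp)
    have W_meas: "W l \<in> borel_measurable R" for l
      unfolding W_def[abs_def] by (intro borel_measurable_sum borel_measurable_times borel_measurable_const comp F G)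

    have S_scale: "(\<integral>x. \<bar>\<Sum>j\<in>J. (c * a j) * f (y j) x\<bar> powr \<alpha> \<partial>m) = \<bar>c\<bar> powr \<alpha> * S y" for c y
    proof -
      have "\<bar>\<Sum>j\<in>J. (c * a j) * f (y j) x\<bar> powr \<alpha> = \<bar>c\<bar> powr \<alpha> * \<bar>\<Sum>j\<in>J. a j * f (y j) x\<bar> powr \<alpha>" for x
        by (simp add: mult.assoc sum_distrib_left[symmetric] abs_mult powr_mult)
      then show ?thesis by (simp add: S_def)
    qed
    have S_meas: "S \<in> borel_measurable (\<Pi>\<^sub>M j\<in>J. borel)"
      unfolding S_def[abs_def] by (rule stable_scale_measurable[OF _ f J]) fact
    \<comment> \<open>Finite-dimensional laws see only functions restricted to \<open>J\<close>;
      \<open>S\<close> does not distinguish them from unrestricted ones.\<close>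
    have S_restrict: "S (\<lambda>j\<in>J. y j) = S y" for y
    proof -
      have "(\<Sum>j\<in>J. a j * f ((\<lambda>j\<in>J. y j) j) x) = (\<Sum>j\<in>J. a j * f (y j) x)" for x
        by (rule sum.cong) auto
      then show ?thesis by (simp only: S_def)
    qed

    \<comment> \<open>The normalizing constant will enter as the frequency \<open>c\<close>. The
      right-hand side is the same for all \<open>l\<close>, which turns the later product into a
      power.\<close>
    have W_char: "char (distr R borel (W l)) c = (\<integral>w'. exp (- (\<bar>c\<bar> powr \<alpha> * K w')) \<partial>P')" for l c
    proof -
      let ?g = "\<lambda>w1 w2. iexp (\<Sum>j\<in>J. (c * a j) * XX l (TT l j w2) w1)"
      let ?h = "\<lambda>y. complex_of_real (exp (- (\<bar>c\<bar> powr \<alpha> * S y)))"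
      have XXp: "(\<lambda>z. XX l (TT l j (snd z)) (fst z)) \<in> borel_measurable (F l \<Otimes>\<^sub>M G l)" for j
        by (rule measurable_field_comp[OF XXF measurable_compose[OF measurable_snd TTG] measurable_fst])
      have g: "(\<lambda>(x, y). ?g x y) \<in> borel_measurable (F l \<Otimes>\<^sub>M G l)"
        unfolding case_prod_unfold using XXp by measurable
      have "char (distr R borel (W l)) c = (\<integral>w. ?g w w \<partial>R)"
        unfolding char_def by (subst integral_distr) (simp_all add: W_meas, simp add: W_def sum_distrib_left mult.assoc)
      \<comment> \<open>Now \<open>w2\<close> fixes the evaluation points and \<open>w1\<close>
        drives the field alone.\<close>
      also have "\<dots> = (\<integral>w2. (\<integral>w1. ?g w1 w2 \<partial>R) \<partial>R)"
        by (rule R.integral_indep_subalgebras[OF F G indep_sets_sum_pair[OF \<open>prob_space R\<close> indep] g, of 1]) simp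
      also have "\<dots> = (\<integral>w2. ?h (\<lambda>j\<in>J. TT l j w2) \<partial>R)"
        unfolding stable_representation_joint_char[OF \<alpha> M0 rep X XX XX_meas J] S_scale S_restrict ..
      also have "\<dots> = (\<integral>w'. ?h (\<lambda>j\<in>J. \<tau> j w') \<partial>P')"
        by (rule same_fdd_integral[OF TT J TT_meas \<tau>]) (use S_meas in measurable)
      also have "\<dots> = (\<integral>w'. exp (- (\<bar>c\<bar> powr \<alpha> * K w')) \<partial>P')"
        unfolding S_restrict K_def by (rule integral_complex_of_real)
      finally show ?thesis .
    qed

    have sum_char: "(\<integral>w. iexp (\<Sum>j\<in>J. a j * (real n powr (- 1 / \<alpha>) * (\<Sum>l<n. XX l (TT l j w) w))) \<partial>R) =
        complex_of_real ((\<integral>w'. exp (- (K w' / real n)) \<partial>P') ^ n)" if n: "0 < n" for n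
    proof -
      define c where "c = real n powr (- 1 / \<alpha>)"
      \<comment> \<open>This is the reason for the normalization: each summand receives exactly 1/n
        of the scale.\<close>
      have c: "\<bar>c\<bar> powr \<alpha> = 1 / real n"
      proof -
        have "\<bar>c\<bar> powr \<alpha> = real n powr (- 1 / \<alpha> * \<alpha>)" unfolding c_def by (simp only: abs_of_nonneg powr_ge_zero powr_powr)
        also have "- 1 / \<alpha> * \<alpha> = - 1" using \<alpha> by simp
        also have "real n powr - 1 = 1 / real n" using n by (simp add: powr_minus_divide)
        finally show ?thesis .
      qed
      have "(\<Sum>j\<in>J. a j * (c * (\<Sum>l<n. XX l (TT l j w) w))) = c * (\<Sum>l<n. W l w)" for w
        unfolding W_def by (subst sum.swap) (simp add: sum_distrib_left mult_ac)
      then have "(\<integral>w. iexp (\<Sum>j\<in>J. a j * (c * (\<Sum>l<n. XX l (TT l j w) w))) \<partial>R) =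
          char (distr R borel (\<lambda>w. \<Sum>l<n. W l w)) c"
        unfolding char_def using borel_measurable_sum[of "{..<n}" W R, OF W_meas]
        by (subst integral_distr) auto
      also have "\<dots> = (\<Prod>l<n. char (distr R borel (W l)) c)"
        by (rule R.char_distr_sum[OF R.indep_vars_subset[OF W_indep]]) simp
      also have "\<dots> = complex_of_real ((\<integral>w'. exp (- (K w' / real n)) \<partial>P') ^ n)"
        unfolding W_char c by simp
      finally show ?thesis unfolding c_def .
    qed

    have K_nonneg: "0 \<le> K w'" for w' unfolding K_def S_def by (rule integral_nonneg_AE) simp
    have "has_stable_integral \<alpha> (m \<Otimes>\<^sub>M P') Q M
        (\<lambda>z. \<Sum>j\<in>J. a j * (case z of (x, w') \<Rightarrow> f (\<tau> j w') x)) (\<lambda>w. \<Sum>j\<in>J. a j * X\<tau> j w)"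
      by (rule has_stable_integral_sum[OF \<alpha> M J X\<tau>])
    then have "integrable (m \<Otimes>\<^sub>M P') (\<lambda>z. \<bar>\<Sum>j\<in>J. a j * (case z of (x, w') \<Rightarrow> f (\<tau> j w') x)\<bar> powr \<alpha>)"
      unfolding has_stable_integral_def L_alpha_def by blast
    then have int: "integrable (m \<Otimes>\<^sub>M P') (\<lambda>(x, w'). \<bar>\<Sum>j\<in>J. a j * f (\<tau> j w') x\<bar> powr \<alpha>)"
      by (simp add: case_prod_unfold)
    have K_int: "integrable P' K"
      unfolding K_def S_def using mP'.integrable_snd[OF int] by simp
    \<comment> \<open>By Fubini, E' K is the scale over m \<times> P' of the same linear combination
      of values of \<open>X\<tau>\<close>, so the two exponents agree.\<close>
    have K_integral: "(\<integral>w'. K w' \<partial>P') =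
        (\<integral>z. \<bar>\<Sum>j\<in>J. a j * (case z of (x, w') \<Rightarrow> f (\<tau> j w') x)\<bar> powr \<alpha> \<partial>(m \<Otimes>\<^sub>M P'))"
      unfolding K_def S_def using mP'.integral_snd[OF int] by (simp add: case_prod_unfold)
    have "(\<lambda>n. complex_of_real ((\<integral>w'. exp (- (K w' / real n)) \<partial>P') ^ n)) \<longlonglongrightarrow>
        complex_of_real (exp (- (\<integral>w'. K w' \<partial>P')))"
      by (intro tendsto_of_real power_expectation_exp_tendsto K_int K_nonneg) fact
    then have "(\<lambda>n. \<integral>w. iexp (\<Sum>j\<in>J. a j * (real n powr (- 1 / \<alpha>) * (\<Sum>l<n. XX l (TT l j w) w))) \<partial>R)
        \<longlonglongrightarrow> complex_of_real (exp (- (\<integral>w'. K w' \<partial>P')))"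
    proof (rule Lim_transform_eventually)
      show "eventually (\<lambda>n. complex_of_real ((\<integral>w'. exp (- (K w' / real n)) \<partial>P') ^ n) =
        (\<integral>w. iexp (\<Sum>j\<in>J. a j * (real n powr (- 1 / \<alpha>) * (\<Sum>l<n. XX l (TT l j w) w))) \<partial>R)) sequentially"
        using eventually_gt_at_top[of 0] by eventually_elim (rule sum_char[symmetric])
    qed
    then show "(\<lambda>n. \<integral>w. iexp (\<Sum>j\<in>J. a j * (real n powr (- 1 / \<alpha>) * (\<Sum>l<n. XX l (TT l j w) w))) \<partial>R)
        \<longlonglongrightarrow> (\<integral>w. iexp (\<Sum>j\<in>J. a j * X\<tau> j w) \<partial>Q)"
      unfolding stable_integral_joint_char[OF \<alpha> M J X\<tau>] K_integral .
  qed
qed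

end
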